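(* Let $S=k[x_1,\dots,x_n]$ be a polynomial ring over a field $k$ and let $M\subset S$ be a monomial ideal with minimal monomial generators $m_1,\dots,m_r$. Then $M$ is generic if and only if the following two conditions hold: (a) the algebraic Scarf complex $F_{\Delta_M}$ equals the minimal free resolution of $S/M$; (b) no variable $x_s$ appears with the same non-zero exponent in $m_i$ and $m_j$ for any edge $\{i,j\}$ of the Scarf complex $\Delta_M$.
   Context: For a monomial $\mathbf{x}^{\mathbf a}=x_1^{a_1}\cdots x_n^{a_n}$ put $\deg_{x_s}(\mathbf{x}^{\mathbf a})=a_s$ and $\operatorname{supp}(\mathbf{x}^{\mathbf a})=\{s: a_s\neq 0\}$. For $\sigma\subseteq\{1,\dots,r\}$ let $m_\sigma=\operatorname{lcm}(m_i: i\in\sigma)$ (with $m_\emptyset=1$) and let $\mathbf a_\sigma\in\mathbb N^n$ be the exponent vector of $m_\sigma$. Generic: the monomial ideal $M=\langle m_1,\dots,m_r\rangle$ (minimal generators) is called generic if for any two distinct minimal generators $m_i,m_j$ which have the same positive degree in some variable $x_s$ there exists a third minimal generator $m_l$ of $M$ which divides $m_{\{i,j\}}=\operatorname{lcm}(m_i,m_j)$ and satisfies $\operatorname{supp}(m_{\{i,j\}}/m_l)=\operatorname{supp}(m_{\{i,j\}})$. Scarf complex: $\Delta_M=\{\sigma\subseteq\{1,\dots,r\} : m_\tau\neq m_\sigma\text{ for all }\tau\subseteq\{1,\dots,r\}\text{ with }\tau\ne\sigma\}$, a simplicial complex. Algebraic Scarf complex: $F_{\Delta_M}=\bigoplus_{\sigma\in\Delta_M}S(-\mathbf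 a_\sigma)$, where $S(-\mathbf a_\sigma)$ is the free $S$-module with one generator $e_\sigma$ in multidegree $\mathbf a_\sigma$, placed in homological degree $\#\sigma$, with differential $$d(e_\sigma)=\sum_{i\in\sigma}\operatorname{sign}(i,\sigma)\,\frac{m_\sigma}{m_{\sigma\setminus\{i\}}}\,e_{\sigma\setminus\{i\}},$$ where $\operatorname{sign}(i,\sigma)=(-1)^{j+1}$ if $i$ is the $j$-th element of $\sigma$ in increasing order. *)

theory Defs
  imports Complex_Main "HOL-Library.Poly_Mapping" "HOL-Library.Function_Algebras"
begin

subsection \<open>The polynomial ring and its ideals\<close>

text \<open>
  \<open>S = k[x\<^sub>s : s :: 'n]\<close> for a finite type \<open>'n\<close> of variables, as the monoid algebra of
  the exponent vectors \<open>'n \<Rightarrow> nat\<close> (with pointwise addition) over \<open>k\<close>.  Monomials are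
  identified with their exponent vectors throughout, so that multiplication, divisibility, exact
  quotient and lcm of monomials are pointwise \<open>+\<close>, \<open>\<le>\<close>, \<open>-\<close> and maximum.
\<close>

type_synonym ('n, 'k) mpoly = "('n \<Rightarrow> nat) \<Rightarrow>\<^sub>0 'k"

definition monom :: "('n \<Rightarrow> nat) \<Rightarrow> ('n, 'k::zero_neq_one) mpoly" where
  "monom a = Poly_Mapping.single a 1"

definition var :: "'n \<Rightarrow> ('n, 'k::zero_neq_one) mpoly" where
  "var s = monom (\<lambda>t. if t = s then 1 else 0)"

definition ideal :: "'a::comm_ring_1 set \<Rightarrow> 'a set" where
  "ideal = module.span (*)"

lemma module_mult: "module ((*) :: 'a::comm_ring_1 \<Rightarrow> 'a \<Rightarrow> 'a)"
  by standard (simp_all add: algebra_simps)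

definition supp :: "('n \<Rightarrow> nat) \<Rightarrow> 'n set" where
  "supp a = {s. a s \<noteq> 0}"

text \<open>Indexing by \<open>j \<noteq> i\<close> makes repeated generators redundant, so the \<open>m j\<close> are distinct.\<close>

definition minimal_monomial_generators ::
    "('n, 'k::comm_ring_1) mpoly set \<Rightarrow> nat \<Rightarrow> (nat \<Rightarrow> 'n \<Rightarrow> nat) \<Rightarrow> bool" where
  "minimal_monomial_generators M r m \<longleftrightarrow>
     ideal {monom (m j) | j. j \<in> {1..r}} = M \<and>
     (\<forall>i\<in>{1..r}. ideal {monom (m j) | j. j \<in> {1..r} \<and> j \<noteq> i} \<noteq> M)"


subsection \<open>Genericity and the Scarf complex\<close>

text \<open>The inserted \<open>0\<close> gives \<open>m\<^sub>\<emptyset> = 1\<close>.\<close>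

definition lcm_exp :: "(nat \<Rightarrow> 'n \<Rightarrow> nat) \<Rightarrow> nat set \<Rightarrow> 'n \<Rightarrow> nat" where
  "lcm_exp m \<sigma> = (\<lambda>s. Max (insert 0 ((\<lambda>i. m i s) ` \<sigma>)))"

definition generic :: "nat \<Rightarrow> (nat \<Rightarrow> 'n \<Rightarrow> nat) \<Rightarrow> bool" where
  "generic r m \<longleftrightarrow>
     (\<forall>i\<in>{1..r}. \<forall>j\<in>{1..r}.
        i \<noteq> j \<and> (\<exists>s. m i s = m j s \<and> m i s > 0) \<longrightarrow>
        (\<exists>l\<in>{1..r}. l \<noteq> i \<and> l \<noteq> j \<and> m l \<le> lcm_exp m {i, j} \<and>
           supp (lcm_exp m {i, j} - m l) = supp (lcm_exp m {i, j})))"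

definition scarf_complex :: "nat \<Rightarrow> (nat \<Rightarrow> 'n \<Rightarrow> nat) \<Rightarrow> nat set set" where
  "scarf_complex r m =
     {\<sigma>. \<sigma> \<subseteq> {1..r} \<and> (\<forall>\<tau>. \<tau> \<subseteq> {1..r} \<and> \<tau> \<noteq> \<sigma> \<longrightarrow> lcm_exp m \<tau> \<noteq> lcm_exp m \<sigma>)}"


subsection \<open>Multigraded free modules and minimal free resolutions\<close>

text \<open>
  An element of the free \<open>S\<close>-module on a basis \<open>B\<close> is the finitely supported function of its
  coordinates; the basis element \<open>e\<^sub>b\<close> is \<open>Poly_Mapping.single b 1\<close>.
\<close>

definition free_module :: "'b set \<Rightarrow> ('b \<Rightarrow>\<^sub>0 'a::zero) set" where
  "free_module B = {v. Poly_Mapping.keys v \<subseteq> B}"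

definition smult :: "'a::comm_ring_1 \<Rightarrow> ('b \<Rightarrow>\<^sub>0 'a) \<Rightarrow> ('b \<Rightarrow>\<^sub>0 'a)" where
  "smult c v = Poly_Mapping.map ((*) c) v"

lemma lookup_smult [simp]: "Poly_Mapping.lookup (smult c v) b = c * Poly_Mapping.lookup v b"
  by (simp add: smult_def Poly_Mapping.map.rep_eq when_def)

global_interpretation smult: module "smult :: 'a::comm_ring_1 \<Rightarrow> ('b \<Rightarrow>\<^sub>0 'a) \<Rightarrow> ('b \<Rightarrow>\<^sub>0 'a)"
  by standard (auto intro!: poly_mapping_eqI simp: lookup_add algebra_simps)

text \<open>The graded piece \<open>S\<^sub>a\<close>.\<close>

definition homogeneous :: "('n \<Rightarrow> nat) \<Rightarrow> ('n, 'k::zero) mpoly \<Rightarrow> bool" where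
  "homogeneous a f \<longleftrightarrow> Poly_Mapping.keys f \<subseteq> {a}"

text \<open>
  The degree \<open>a\<close> piece of \<open>\<Oplus>\<^sub>b S(-deg b)\<close>, where \<open>e\<^sub>b\<close> has multidegree \<open>deg b\<close>.
\<close>

definition homogeneous_vec ::
    "('b \<Rightarrow> 'n \<Rightarrow> nat) \<Rightarrow> ('n \<Rightarrow> nat) \<Rightarrow> ('b \<Rightarrow>\<^sub>0 ('n, 'k::zero) mpoly) \<Rightarrow> bool" where
  "homogeneous_vec deg a v \<longleftrightarrow>
     (\<forall>b. Poly_Mapping.keys (Poly_Mapping.lookup v b) \<subseteq> {u. u + deg b = a})"

text \<open>Homomorphisms of degree \<open>0\<close> between the multigraded free modules on \<open>B\<close> and \<open>B'\<close>.\<close>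

definition graded_hom ::
    "('b \<Rightarrow> 'n \<Rightarrow> nat) \<Rightarrow> 'b set \<Rightarrow> 'b set \<Rightarrow>
     (('b \<Rightarrow>\<^sub>0 ('n, 'k::comm_ring_1) mpoly) \<Rightarrow> ('b \<Rightarrow>\<^sub>0 ('n, 'k) mpoly)) \<Rightarrow> bool" where
  "graded_hom deg B B' d \<longleftrightarrow>
     d ` free_module B \<subseteq> free_module B' \<and>
     (\<forall>u\<in>free_module B. \<forall>v\<in>free_module B. d (u + v) = d u + d v) \<and>
     (\<forall>c. \<forall>v\<in>free_module B. d (smult c v) = smult c (d v)) \<and>
     (\<forall>a. \<forall>v\<in>free_module B. homogeneous_vec deg a v \<longrightarrow> homogeneous_vec deg a (d v))"

text \<open>
  \<open>S/M\<close> is the set \<open>range (residue_class M)\<close>, with the operations and the multigrading induced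
  from representatives.
\<close>

definition residue_class :: "'a::comm_ring_1 set \<Rightarrow> 'a \<Rightarrow> 'a set" where
  "residue_class M f = {g. g - f \<in> M}"

definition graded_hom_to_quotient ::
    "('b \<Rightarrow> 'n \<Rightarrow> nat) \<Rightarrow> 'b set \<Rightarrow> ('n, 'k::comm_ring_1) mpoly set \<Rightarrow>
     (('b \<Rightarrow>\<^sub>0 ('n, 'k) mpoly) \<Rightarrow> ('n, 'k) mpoly set) \<Rightarrow> bool" where
  "graded_hom_to_quotient deg B M \<epsilon> \<longleftrightarrow>
     \<epsilon> ` free_module B \<subseteq> range (residue_class M) \<and>
     (\<forall>u\<in>free_module B. \<forall>v\<in>free_module B. \<forall>f g.
        \<epsilon> u = residue_class M f \<and> \<epsilon> v = residue_class M g \<longrightarrow>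
        \<epsilon> (u + v) = residue_class M (f + g)) \<and>
     (\<forall>c. \<forall>v\<in>free_module B. \<forall>f.
        \<epsilon> v = residue_class M f \<longrightarrow> \<epsilon> (smult c v) = residue_class M (c * f)) \<and>
     (\<forall>a. \<forall>v\<in>free_module B. homogeneous_vec deg a v \<longrightarrow>
        (\<exists>f. homogeneous a f \<and> \<epsilon> v = residue_class M f))"

text \<open>
  The multigraded free modules \<open>F\<^sub>i\<close> on the bases \<open>B i\<close> with the maps
  \<open>d (Suc i) : F\<^sub>i\<^sub>+\<^sub>1 \<rightarrow> F\<^sub>i\<close> form a free resolution of \<open>S/M\<close> if
  \<open>\<dots> \<rightarrow> F\<^sub>2 \<rightarrow> F\<^sub>1 \<rightarrow> F\<^sub>0 \<rightarrow> S/M \<rightarrow> 0\<close> is exact for some augmentation \<open>\<epsilon>\<close>.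
  The value of \<open>d 0\<close> is irrelevant.
\<close>

definition free_resolution ::
    "(nat \<Rightarrow> 'b set) \<Rightarrow> ('b \<Rightarrow> 'n \<Rightarrow> nat) \<Rightarrow>
     (nat \<Rightarrow> ('b \<Rightarrow>\<^sub>0 ('n, 'k::comm_ring_1) mpoly) \<Rightarrow> ('b \<Rightarrow>\<^sub>0 ('n, 'k) mpoly)) \<Rightarrow>
     ('n, 'k) mpoly set \<Rightarrow> bool" where
  "free_resolution B deg d M \<longleftrightarrow>
     (\<forall>i. graded_hom deg (B (Suc i)) (B i) (d (Suc i))) \<and>
     (\<exists>\<epsilon>. graded_hom_to_quotient deg (B 0) M \<epsilon> \<and>
        \<epsilon> ` free_module (B 0) = range (residue_class M) \<and>
        {v \<in> free_module (B 0). \<epsilon> v = residue_class M 0} = d 1 ` free_module (B 1)) \<and>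
     (\<forall>i. {v \<in> free_module (B (Suc i)). d (Suc i) v = 0} =
        d (Suc (Suc i)) ` free_module (B (Suc (Suc i))))"

text \<open>
  Minimality: the differential maps \<open>F\<^sub>i\<^sub>+\<^sub>1\<close> into \<open>\<mm> F\<^sub>i\<close>, where \<open>\<mm>\<close> is the ideal
  generated by the variables.
\<close>

definition minimal_free_resolution ::
    "(nat \<Rightarrow> 'b set) \<Rightarrow> ('b \<Rightarrow> 'n \<Rightarrow> nat) \<Rightarrow>
     (nat \<Rightarrow> ('b \<Rightarrow>\<^sub>0 ('n, 'k::comm_ring_1) mpoly) \<Rightarrow> ('b \<Rightarrow>\<^sub>0 ('n, 'k) mpoly)) \<Rightarrow>
     ('n, 'k) mpoly set \<Rightarrow> bool" where
  "minimal_free_resolution B deg d M \<longleftrightarrow>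
     free_resolution B deg d M \<and>
     (\<forall>i. d (Suc i) ` free_module (B (Suc i)) \<subseteq>
        smult.span {smult c v | c v. c \<in> ideal (range var) \<and> v \<in> free_module (B i)})"


subsection \<open>The algebraic Scarf complex\<close>

definition face_sign :: "nat \<Rightarrow> nat set \<Rightarrow> 'k::comm_ring_1" where
  "face_sign i \<sigma> = (-1) ^ (card {t \<in> \<sigma>. t \<le> i} + 1)"

definition scarf_basis :: "nat \<Rightarrow> (nat \<Rightarrow> 'n \<Rightarrow> nat) \<Rightarrow> nat \<Rightarrow> nat set set" where
  "scarf_basis r m i = {\<sigma> \<in> scarf_complex r m. card \<sigma> = i}"

definition scarf_boundary ::
    "(nat \<Rightarrow> 'n \<Rightarrow> nat) \<Rightarrow> nat set \<Rightarrow> (nat set \<Rightarrow>\<^sub>0 ('n, 'k::comm_ring_1) mpoly)" where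
  "scarf_boundary m \<sigma> =
     (\<Sum>i\<in>\<sigma>. Poly_Mapping.single (\<sigma> - {i})
        (Poly_Mapping.single (lcm_exp m \<sigma> - lcm_exp m (\<sigma> - {i})) (face_sign i \<sigma>)))"

text \<open>The \<open>S\<close>-linear extension of \<open>e\<^sub>\<sigma> \<mapsto> scarf_boundary m \<sigma>\<close>.\<close>

definition scarf_differential ::
    "(nat \<Rightarrow> 'n \<Rightarrow> nat) \<Rightarrow> (nat set \<Rightarrow>\<^sub>0 ('n, 'k::comm_ring_1) mpoly) \<Rightarrow>
     (nat set \<Rightarrow>\<^sub>0 ('n, 'k) mpoly)" where
  "scarf_differential m v =
     (\<Sum>\<sigma>\<in>Poly_Mapping.keys v. smult (Poly_Mapping.lookup v \<sigma>) (scarf_boundary m \<sigma>))"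

text \<open>
  \<open>F\<^sub>\<Delta>\<close> has in homological degree \<open>i\<close> the free module on the faces with \<open>i\<close> elements, with
  \<open>e\<^sub>\<sigma>\<close> in multidegree \<open>a\<^sub>\<sigma>\<close>.
\<close>

definition algebraic_scarf_complex_is_minimal_free_resolution ::
    "nat \<Rightarrow> (nat \<Rightarrow> 'n \<Rightarrow> nat) \<Rightarrow> ('n, 'k::comm_ring_1) mpoly set \<Rightarrow> bool" where
  "algebraic_scarf_complex_is_minimal_free_resolution r m M \<longleftrightarrow>
     minimal_free_resolution (scarf_basis r m) (lcm_exp m) (\<lambda>_. scarf_differential m) M"


subsection \<open>Monomials and exponent vectors\<close>

lemma monom_dvd_monom_iff:
  "(monom a :: ('n, 'k::comm_ring_1) mpoly) dvd monom b \<longleftrightarrow> a \<le> b"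
proof
  assume "(monom a :: ('n, 'k) mpoly) dvd monom b"
  then obtain q :: "('n, 'k) mpoly" where q: "monom b = monom a * q"
    by (rule dvdE)
  have "b \<in> Poly_Mapping.keys (monom b :: ('n, 'k) mpoly)"
    by (simp add: monom_def)
  then have "b \<in> Poly_Mapping.keys (monom a * q)"
    by (simp only: q)
  then obtain u where "b = a + u"
    using keys_mult[of "monom a" q] by (auto simp: monom_def)
  then show "a \<le> b"
    by (simp add: le_fun_def)
next
  assume "a \<le> b"
  then have "a + (b - a) = b"
    by (intro ext) (simp add: le_funD)
  then have "(monom a :: ('n, 'k) mpoly) * monom (b - a) = monom b"
    by (simp add: monom_def mult_single)
  then show "(monom a :: ('n, 'k) mpoly) dvd monom b"
    by (rule dvdI[OF sym])
qed

lemma lcm_exp_le_iff: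
  assumes "finite \<sigma>"
  shows "lcm_exp m \<sigma> \<le> b \<longleftrightarrow> (\<forall>i\<in>\<sigma>. m i \<le> b)"
  using assms by (auto simp: lcm_exp_def le_fun_def)

lemma scarf_differential_basis:
  "scarf_differential m (Poly_Mapping.single \<sigma> 1) = scarf_boundary m \<sigma>"
  by (simp add: scarf_differential_def)

end

theory Submission
  imports Defs
begin

text \<open>
  In multidegree \<open>b\<close> the Scarf complex becomes the simplicial chain complex of the faces \<open>\<sigma>\<close> with
  \<open>a\<^sub>\<sigma> \<le> b\<close>, a subcomplex of the full simplex on \<open>{i. m\<^sub>i \<le> b}\<close>, which is a cone.  If \<open>M\<close> is generic,
  the lcm \<open>a\<^sub>\<sigma>\<close> of every non-face \<open>\<sigma>\<close> is divided by some \<open>m\<^sub>l\<close> with strictly smaller exponent at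
  every variable of \<open>a\<^sub>\<sigma>\<close>.  Adding \<open>l\<close> to \<open>\<sigma>\<close>, or removing it, does not change \<open>a\<^sub>\<sigma>\<close>, so the
  non-faces cancel in pairs and the subcomplex is acyclic.  Conversely, exactness in homological
  degree 1 already makes every vertex \<open>j\<close> adjacent to some \<open>l\<close> with \<open>m\<^sub>l\<close> dividing \<open>lcm(m\<^sub>i, m\<^sub>j)\<close>, and
  (b) shows that a pair \<open>i, j\<close> of least lcm violating genericity has no such neighbour.
\<close>

subsection \<open>Faces and least common multiples\<close>

lemma lcm_exp_mono: "finite B \<Longrightarrow> A \<subseteq> B \<Longrightarrow> lcm_exp m A \<le> lcm_exp m B"
  using lcm_exp_le_iff[of B m "lcm_exp m B"] lcm_exp_le_iff[of A m "lcm_exp m B"] finite_subset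
  by blast

lemma le_lcm_exp: "finite A \<Longrightarrow> i \<in> A \<Longrightarrow> m i \<le> lcm_exp m A"
  using lcm_exp_le_iff[of A m "lcm_exp m A"] by blast

lemma lcm_exp_empty [simp]: "lcm_exp m {} = 0"
  by (simp add: lcm_exp_def fun_eq_iff)

lemma lcm_exp_singleton [simp]: "lcm_exp m {i} = m i"
  by (simp add: lcm_exp_def fun_eq_iff)

lemma lcm_exp_attained:
  assumes "finite A" "0 < lcm_exp m A s"
  obtains i where "i \<in> A" "m i s = lcm_exp m A s"
proof -
  have "lcm_exp m A s \<in> insert 0 ((\<lambda>i. m i s) ` A)"
    unfolding lcm_exp_def using assms(1) by (intro Max_in) auto
  then show ?thesis using assms(2) that by auto
qed

lemma lcm_exp_pair: "lcm_exp m {i, j} s = max (m i s) (m j s)"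
  by (simp add: lcm_exp_def)

lemma finite_subset_range [simp, intro]: "\<sigma> \<subseteq> {1..r::nat} \<Longrightarrow> finite \<sigma>"
  using finite_subset by blast

text \<open>A local test for faces. If \<open>m i\<close> divides the lcm over
  \<open>\<sigma> - {i}\<close>, then inserting and deleting \<open>i\<close> both keep the lcm, and
  one of them changes \<sigma>. Conversely, another set \<tau> with the same lcm yields an index
  failing the test: a member of \<tau> outside \<sigma> or, if \<tau> is a proper subset, a member
  of \<sigma> missing from \<tau>.\<close>

lemma scarf_complex_iff:
  "\<sigma> \<in> scarf_complex r m \<longleftrightarrow>
     \<sigma> \<subseteq> {1..r} \<and> (\<forall>i\<in>{1..r}. \<not> m i \<le> lcm_exp m (\<sigma> - {i}))"
proof (intro iffI conjI ballI notI)
  assume S: "\<sigma> \<in> scarf_complex r m"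
  then show sub: "\<sigma> \<subseteq> {1..r}" by (simp add: scarf_complex_def)
  fix i assume i: "i \<in> {1..r}" "m i \<le> lcm_exp m (\<sigma> - {i})"
  have "lcm_exp m (insert i \<sigma>) \<le> lcm_exp m (\<sigma> - {i})"
  proof (subst lcm_exp_le_iff)
    show "\<forall>j\<in>insert i \<sigma>. m j \<le> lcm_exp m (\<sigma> - {i})"
    proof
      fix j assume "j \<in> insert i \<sigma>"
      then show "m j \<le> lcm_exp m (\<sigma> - {i})"
        using i(2) sub le_lcm_exp[of "\<sigma> - {i}" j m] by (cases "j = i") auto
    qed
  qed (use sub in auto)
  moreover have "lcm_exp m (\<sigma> - {i}) \<le> lcm_exp m \<sigma>" "lcm_exp m \<sigma> \<le> lcm_exp m (insert i \<sigma>)"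
    using sub by (auto intro!: lcm_exp_mono)
  ultimately have "lcm_exp m (insert i \<sigma>) = lcm_exp m \<sigma>" "lcm_exp m (\<sigma> - {i}) = lcm_exp m \<sigma>"
    by auto
  moreover have "insert i \<sigma> \<subseteq> {1..r}" "\<sigma> - {i} \<subseteq> {1..r}" using sub i by auto
  moreover have "\<tau> = \<sigma>" if "\<tau> \<subseteq> {1..r}" "lcm_exp m \<tau> = lcm_exp m \<sigma>" for \<tau>
    using S that by (simp add: scarf_complex_def) blast
  ultimately have "insert i \<sigma> = \<sigma>" "\<sigma> - {i} = \<sigma>" by metis+
  then show False by blast
next
  assume R: "\<sigma> \<subseteq> {1..r} \<and> (\<forall>i\<in>{1..r}. \<not> m i \<le> lcm_exp m (\<sigma> - {i}))"
  have "\<tau> = \<sigma>" if t: "\<tau> \<subseteq> {1..r}" "lcm_exp m \<tau> = lcm_exp m \<sigma>" for \<tau>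
  proof (rule ccontr)
    assume "\<tau> \<noteq> \<sigma>"
    then consider i where "i \<in> \<tau>" "i \<notin> \<sigma>" | i where "i \<in> \<sigma>" "i \<notin> \<tau>" by blast
    then show False
    proof cases
      case 1
      then have "m i \<le> lcm_exp m (\<sigma> - {i})" using le_lcm_exp[of \<tau> i m] t by simp
      then show False using R t 1 by blast
    next
      case 2
      show False
      proof (cases "\<tau> \<subseteq> \<sigma>")
        case True
        then have "lcm_exp m \<tau> \<le> lcm_exp m (\<sigma> - {i})"
          using 2 R by (intro lcm_exp_mono) auto
        moreover have "m i \<le> lcm_exp m \<sigma>" using 2 R by (intro le_lcm_exp) auto
        ultimately have "m i \<le> lcm_exp m (\<sigma> - {i})" using t by simp
        then show False using R 2 by blast
      next
        case False
        then obtain j where j: "j \<in> \<tau>" "j \<notin> \<sigma>" by blast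
        then have "m j \<le> lcm_exp m (\<sigma> - {j})" using le_lcm_exp[of \<tau> j m] t by simp
        then show False using R t j by blast
      qed
    qed
  qed
  then show "\<sigma> \<in> scarf_complex r m" using R by (auto simp: scarf_complex_def)
qed

lemma scarf_complex_subset: "\<sigma> \<in> scarf_complex r m \<Longrightarrow> \<sigma> \<subseteq> {1..r}"
  by (simp add: scarf_complex_def)

text \<open>Shrinking \<sigma> shrinks each lcm in the test of \<open>scarf_complex_iff\<close>, so
  no index can start to fail it.\<close>

lemma scarf_complex_downward:
  assumes "\<sigma> \<in> scarf_complex r m" "\<tau> \<subseteq> \<sigma>"
  shows "\<tau> \<in> scarf_complex r m"
proof -
  have "lcm_exp m (\<tau> - {i}) \<le> lcm_exp m (\<sigma> - {i})" for i
    using assms scarf_complex_subset[of \<sigma> r m] by (intro lcm_exp_mono) auto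
  then show ?thesis using assms unfolding scarf_complex_iff by (meson order_trans)
qed

section \<open>Strict divisibility and non-faces\<close>

definition strictly_divides :: "('n \<Rightarrow> nat) \<Rightarrow> ('n \<Rightarrow> nat) \<Rightarrow> bool" where
  "strictly_divides a b \<longleftrightarrow> (\<forall>s. a s = 0 \<or> a s < b s)"

lemma strictly_divides_mono: "strictly_divides a b \<Longrightarrow> b \<le> c \<Longrightarrow> strictly_divides a c"
  unfolding strictly_divides_def le_fun_def by (meson order_less_le_trans)

lemma strictly_divides_le: "strictly_divides a b \<Longrightarrow> a \<le> b"
  unfolding strictly_divides_def le_fun_def by (metis less_imp_le zero_le)

text \<open>Connects the pointwise form with the support condition in \<open>generic\<close>;
  pointwise, stability under enlarging \<open>b\<close> is immediate.\<close>

lemma strictly_divides_iff_supp: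
  "strictly_divides a b \<longleftrightarrow> a \<le> b \<and> supp (b - a) = supp b"
proof -
  have "a s = 0 \<or> a s < b s \<longleftrightarrow> a s \<le> b s \<and> (b s - a s \<noteq> 0 \<longleftrightarrow> b s \<noteq> 0)" for s
    by linarith
  then show ?thesis
    by (auto simp: strictly_divides_def supp_def le_fun_def set_eq_iff)
qed

text \<open>At a variable of positive exponent the maximum is never attained by \<open>l\<close>,
  since \<open>m l\<close> stays strictly below it; the other indices already produce the
  lcm.\<close>

lemma lcm_exp_remove_strictly_divides:
  assumes "strictly_divides (m l) (lcm_exp m \<sigma>)" "finite \<sigma>"
  shows "lcm_exp m (\<sigma> - {l}) = lcm_exp m \<sigma>"
proof (rule antisym)
  show "lcm_exp m (\<sigma> - {l}) \<le> lcm_exp m \<sigma>"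
    using assms by (auto intro: lcm_exp_mono)
  show "lcm_exp m \<sigma> \<le> lcm_exp m (\<sigma> - {l})"
  proof (rule le_funI)
    fix s
    show "lcm_exp m \<sigma> s \<le> lcm_exp m (\<sigma> - {l}) s"
    proof (cases "lcm_exp m \<sigma> s = 0")
      case False
      then obtain i where i: "i \<in> \<sigma>" "m i s = lcm_exp m \<sigma> s"
        using assms(2) lcm_exp_attained[of \<sigma> m s] by auto
      then have "i \<noteq> l" using assms(1) False by (auto simp: strictly_divides_def dest: spec[of _ s])
      then have "m i \<le> lcm_exp m (\<sigma> - {l})" using i assms by (intro le_lcm_exp) auto
      then show ?thesis using i by (metis le_funD)
    qed simp
  qed
qed

text \<open>A non-face has an \<open>m i\<close> dividing the lcm of \<open>\<sigma> - {i}\<close>.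
  Either it strictly divides the whole lcm, or it touches the lcm at some \<open>s\<close>, where a
  member \<open>j\<close> of \<sigma> ties with it; genericity of the pair \<open>i\<close>,
  \<open>j\<close> then gives a strict divisor of \<open>lcm_exp m {i, j}\<close>, which divides the
  lcm.\<close>

lemma generic_strictly_divides:
  assumes "generic r m" "\<sigma> \<subseteq> {1..r}" "\<sigma> \<notin> scarf_complex r m"
  shows "\<exists>l\<in>{1..r}. strictly_divides (m l) (lcm_exp m \<sigma>)"
proof -
  obtain i where i: "i \<in> {1..r}" "m i \<le> lcm_exp m (\<sigma> - {i})"
    using assms by (auto simp: scarf_complex_iff)
  have le: "lcm_exp m (\<sigma> - {i}) \<le> lcm_exp m \<sigma>" using assms by (intro lcm_exp_mono) auto
  show ?thesis
  proof (cases "strictly_divides (m i) (lcm_exp m \<sigma>)")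
    case False
    then obtain s where s: "m i s > 0" "m i s \<ge> lcm_exp m \<sigma> s"
      by (auto simp: strictly_divides_def not_less)
    \<comment> \<open>Squeezed: this exponent lies between \<open>m i s\<close> and
      \<open>lcm_exp m \<sigma> s\<close>, and the latter is at most \<open>m i s\<close>.\<close>
    then have "lcm_exp m (\<sigma> - {i}) s = m i s"
      using le i(2) by (meson antisym le_funD order_trans)
    then obtain j where j: "j \<in> \<sigma> - {i}" "m j s = m i s"
      using s(1) assms(2) lcm_exp_attained[of "\<sigma> - {i}" m s] by auto
    have "j \<in> {1..r}" "i \<noteq> j" "m i s = m j s" using j assms(2) by auto
    then obtain l where l: "l \<in> {1..r}" "strictly_divides (m l) (lcm_exp m {i, j})"
      using assms(1) i(1) s(1) unfolding generic_def strictly_divides_iff_supp by blast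
    have "m j \<le> lcm_exp m \<sigma>" using j assms by (intro le_lcm_exp) auto
    then have "lcm_exp m {i, j} \<le> lcm_exp m \<sigma>"
      using i le by (auto simp: lcm_exp_le_iff intro: order_trans)
    then show ?thesis using l strictly_divides_mono by blast
  qed (use i in blast)
qed

subsection \<open>Signs, boundaries and cones\<close>

text \<open>\<open>face_sign i \<sigma>\<close> makes sense for \<open>i\<close> outside \<sigma> as
  well, so the exchange rules below reduce to asking whether the new vertex is counted up to
  \<open>i\<close>.\<close>

lemma face_sign_insert:
  assumes "finite \<sigma>" "j \<notin> \<sigma>"
  shows "(face_sign i (insert j \<sigma>) :: 'k::comm_ring_1) =
    (if j \<le> i then - face_sign i \<sigma> else face_sign i \<sigma>)"
proof -
  have "{t \<in> insert j \<sigma>. t \<le> i} = (if j \<le> i then insert j {t \<in> \<sigma>. t \<le> i} else {t \<in> \<sigma>. t \<le> i})"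
    by auto
  then show ?thesis using assms by (simp add: face_sign_def)
qed

lemma face_sign_square [simp]: "face_sign i \<sigma> * face_sign i \<sigma> = (1 :: 'k::comm_ring_1)"
  by (simp add: face_sign_def flip: power_mult_distrib)

text \<open>The source of \<open>boundary_boundary\<close>: the two sides carry the signs of
  deleting \<open>i\<close> and \<open>j\<close> in either order.\<close>

lemma face_sign_swap:
  assumes "finite \<sigma>" "i \<notin> \<sigma>" "j \<notin> \<sigma>" "i \<noteq> j"
  shows "face_sign i (insert i \<sigma>) * face_sign j (insert j (insert i \<sigma>)) =
    - (face_sign j (insert j \<sigma>) * face_sign i (insert j (insert i \<sigma>)) :: 'k::comm_ring_1)"
  using assms by (auto simp: face_sign_insert)

text \<open>The form of the exchange needed when one of the two vertices is a cone apex.\<close>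

lemma face_sign_swap':
  assumes "finite \<sigma>" "i \<notin> \<sigma>" "j \<notin> \<sigma>" "i \<noteq> j"
  shows "face_sign i (insert i \<sigma>) * face_sign j (insert j \<sigma>) =
    - (face_sign j (insert j (insert i \<sigma>)) * face_sign i (insert j (insert i \<sigma>)) :: 'k::comm_ring_1)"
  using assms by (auto simp: face_sign_insert)

text \<open>The augmented simplicial boundary of the full simplex on \<open>{1..r}\<close>, with
  chains as coefficient functions: the coefficient at \<tau> is collected from the sets with one
  more element, and the empty set counts as a face.\<close>

definition boundary :: "nat \<Rightarrow> (nat set \<Rightarrow> 'k::comm_ring_1) \<Rightarrow> nat set \<Rightarrow> 'k" where
  "boundary r f \<tau> = (\<Sum>i\<in>{1..r} - \<tau>. face_sign i (insert i \<tau>) * f (insert i \<tau>))"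

text \<open>The join with the apex \<open>l\<close>, signed so as to be the contracting homotopy of
  \<open>boundary_cone\<close>.\<close>

definition cone :: "nat \<Rightarrow> (nat set \<Rightarrow> 'k::comm_ring_1) \<Rightarrow> nat set \<Rightarrow> 'k" where
  "cone l f \<sigma> = (if l \<in> \<sigma> then face_sign l \<sigma> * f (\<sigma> - {l}) else 0)"

text \<open>Splitting at the diagonal pairs each \<open>F i j\<close> with \<open>F j i\<close>
  directly, so no division by 2 occurs and every characteristic is covered.\<close>

lemma sum_off_diagonal_antisymmetric:
  fixes F :: "'i::linorder \<Rightarrow> 'i \<Rightarrow> 'k::comm_ring_1"
  assumes "finite A" "\<And>i j. i \<in> A \<Longrightarrow> j \<in> A \<Longrightarrow> i < j \<Longrightarrow> F i j = - F j i"
  shows "(\<Sum>i\<in>A. \<Sum>j\<in>A - {i}. F i j) = 0"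
proof -
  have "(\<Sum>j\<in>A - {i}. F i j) =
      (\<Sum>j\<in>A. if i < j then F i j else 0) + (\<Sum>j\<in>A. if j < i then F i j else 0)" for i
  proof -
    have "(\<Sum>j\<in>A - {i}. F i j) = (\<Sum>j\<in>A. if i = j then 0 else F i j)"
      using assms(1) by (intro sum.mono_neutral_cong_left) auto
    also have "\<dots> = (\<Sum>j\<in>A. (if i < j then F i j else 0) + (if j < i then F i j else 0))"
      by (intro sum.cong) auto
    finally show ?thesis by (simp add: sum.distrib)
  qed
  then have "(\<Sum>i\<in>A. \<Sum>j\<in>A - {i}. F i j) =
      (\<Sum>i\<in>A. \<Sum>j\<in>A. if i < j then F i j else 0) + (\<Sum>i\<in>A. \<Sum>j\<in>A. if j < i then F i j else 0)"
    by (simp add: sum.distrib)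
  also have "(\<Sum>i\<in>A. \<Sum>j\<in>A. if j < i then F i j else 0) =
      (\<Sum>i\<in>A. \<Sum>j\<in>A. if i < j then F j i else 0)"
    by (rule sum.swap)
  finally show ?thesis
    using assms(2) by (simp flip: sum.distrib, intro sum.neutral ballI) auto
qed

lemma boundary_boundary:
  assumes "finite \<tau>"
  shows "boundary r (boundary r f) \<tau> = 0"
proof -
  let ?F = "\<lambda>i j. face_sign i (insert i \<tau>) * face_sign j (insert j (insert i \<tau>)) *
    f (insert j (insert i \<tau>))"
  have "boundary r (boundary r f) \<tau> = (\<Sum>i\<in>{1..r} - \<tau>. \<Sum>j\<in>{1..r} - \<tau> - {i}. ?F i j)"
    unfolding boundary_def sum_distrib_left
    by (intro sum.cong) (auto simp: mult.assoc)
  also have "\<dots> = 0"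
    using assms by (intro sum_off_diagonal_antisymmetric)
      (auto simp: face_sign_swap insert_commute)
  finally show ?thesis .
qed

text \<open>The cone contracts the full simplex. If \<open>l\<close> is not in \<tau>, only the set
  obtained by adding \<open>l\<close> contributes. If \<open>l\<close> is in \<tau>, the term
  \<open>f \<tau>\<close> arises from the boundary inside the cone, and all other terms cancel by
  \<open>face_sign_swap'\<close>.\<close>

lemma boundary_cone:
  fixes f :: "nat set \<Rightarrow> 'k::comm_ring_1"
  assumes "finite \<tau>" "l \<in> {1..r}"
  shows "boundary r (cone l f) \<tau> + cone l (boundary r f) \<tau> = f \<tau>"
proof (cases "l \<in> \<tau>")
  case False
  have "boundary r (cone l f) \<tau> =
      (\<Sum>i\<in>{1..r} - \<tau>. if i = l then face_sign l (insert l \<tau>) * (face_sign l (insert l \<tau>) * f \<tau>) else 0)"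
    unfolding boundary_def cone_def using False by (intro sum.cong) auto
  also have "\<dots> = f \<tau>" using assms False by (simp flip: mult.assoc)
  finally show ?thesis using False by (simp add: cone_def)
next
  case True
  define \<rho> where "\<rho> = \<tau> - {l}"
  have \<rho>: "\<tau> = insert l \<rho>" "l \<notin> \<rho>" "finite \<rho>" using True assms by (auto simp: \<rho>_def)
  \<comment> \<open>Besides the vertices outside \<tau>, the boundary at \<rho> can add back
    \<open>l\<close>; that term is the one giving \<open>f \<tau>\<close>.\<close>
  have "cone l (boundary r f) \<tau> = (\<Sum>i\<in>insert l ({1..r} - \<tau>).
      face_sign l \<tau> * (face_sign i (insert i \<rho>) * f (insert i \<rho>)))"
  proof -
    have "{1..r} - \<rho> = insert l ({1..r} - \<tau>)" using \<rho> assms by auto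
    then show ?thesis using True unfolding cone_def boundary_def \<rho>_def[symmetric]
      by (simp only: sum_distrib_left if_True)
  qed
  also have "\<dots> = f \<tau> + (\<Sum>i\<in>{1..r} - \<tau>. face_sign l \<tau> * (face_sign i (insert i \<rho>) * f (insert i \<rho>)))"
    using True \<rho>(1) by (subst sum.insert) (simp_all flip: mult.assoc)
  also have "(\<Sum>i\<in>{1..r} - \<tau>. face_sign l \<tau> * (face_sign i (insert i \<rho>) * f (insert i \<rho>))) =
     (\<Sum>i\<in>{1..r} - \<tau>. - (face_sign i (insert i \<tau>) * cone l f (insert i \<tau>)))"
  proof (intro sum.cong refl)
    fix i assume i: "i \<in> {1..r} - \<tau>"
    have eq: "insert i \<tau> - {l} = insert i \<rho>" using i \<rho> by auto
    have "face_sign l \<tau> * face_sign i (insert i \<rho>) =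
        - (face_sign i (insert i \<tau>) * (face_sign l (insert i \<tau>) :: 'k))"
      using face_sign_swap'[of \<rho> l i] i \<rho> by simp
    then show "face_sign l \<tau> * (face_sign i (insert i \<rho>) * f (insert i \<rho>)) =
        - (face_sign i (insert i \<tau>) * cone l f (insert i \<tau>))"
      using True eq by (simp add: cone_def flip: mult.assoc)
  qed
  also have "\<dots> = - boundary r (cone l f) \<tau>" by (simp only: boundary_def sum_negf)
  finally show ?thesis by simp
qed

lemma boundary_nonzeroE:
  assumes "boundary r f \<tau> \<noteq> 0"
  obtains i where "i \<in> {1..r}" "i \<notin> \<tau>" "f (insert i \<tau>) \<noteq> 0"
  using assms unfolding boundary_def by (metis (no_types, lifting) DiffE mult_zero_right sum.neutral)

lemma boundary_diff: "boundary r (\<lambda>\<sigma>. f \<sigma> - g \<sigma>) \<tau> = boundary r f \<tau> - boundary r g \<tau>"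
  by (simp add: boundary_def right_diff_distrib sum_subtractf)

lemma cone_nonzero:
  assumes "cone l f \<sigma> \<noteq> 0"
  shows "l \<in> \<sigma>" "f (\<sigma> - {l}) \<noteq> 0"
  using assms by (auto simp: cone_def split: if_splits)

section \<open>Acyclicity of the Scarf complex in one multidegree\<close>

definition faces_below :: "nat \<Rightarrow> (nat \<Rightarrow> 'n \<Rightarrow> nat) \<Rightarrow> ('n \<Rightarrow> nat) \<Rightarrow> nat \<Rightarrow> nat set set" where
  "faces_below r m b k = {\<sigma>. \<sigma> \<subseteq> {1..r} \<and> lcm_exp m \<sigma> \<le> b \<and> card \<sigma> = k}"

text \<open>
  Toggling in a non-face \<open>\<sigma>\<close> an index \<open>L (lcm_exp m \<sigma>)\<close> whose monomial strictly divides
  \<open>lcm_exp m \<sigma>\<close> preserves the lcm, so subtracting the boundary of the cone with these apexes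
  removes the non-faces of top lcm degree from a chain with boundary in the Scarf complex.
\<close>

lemma push_into_scarf_complex:
  fixes g :: "nat set \<Rightarrow> 'k::comm_ring_1" and m :: "nat \<Rightarrow> 'n::finite \<Rightarrow> nat"
  assumes "\<And>\<sigma>. \<sigma> \<subseteq> {1..r} \<Longrightarrow> \<sigma> \<notin> scarf_complex r m \<Longrightarrow>
      \<exists>l\<in>{1..r}. strictly_divides (m l) (lcm_exp m \<sigma>)"
    and "\<And>\<sigma>. g \<sigma> \<noteq> 0 \<Longrightarrow> \<sigma> \<in> faces_below r m b k"
    and "\<And>\<sigma>. g \<sigma> \<noteq> 0 \<Longrightarrow> \<sigma> \<notin> scarf_complex r m \<Longrightarrow> (\<Sum>s\<in>UNIV. lcm_exp m \<sigma> s) < N"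
    and "\<And>\<tau>. \<tau> \<subseteq> {1..r} \<Longrightarrow> boundary r g \<tau> \<noteq> 0 \<Longrightarrow> \<tau> \<in> scarf_complex r m"
  shows "\<exists>g'. (\<forall>\<sigma>. g' \<sigma> \<noteq> 0 \<longrightarrow> \<sigma> \<in> faces_below r m b k \<inter> scarf_complex r m) \<and>
    (\<forall>\<tau>\<subseteq>{1..r}. boundary r g' \<tau> = boundary r g \<tau>)"
  using assms(2-)
\<comment> \<open>\<open>N\<close> strictly bounds the total degree of the lcm on non-faces in the
  support. At 0 none are left and \<open>g\<close> itself works; each round lowers the bound by
  one.\<close>
proof (induction N arbitrary: g)
  case 0
  then show ?case by blast
next
  case (Suc N)
  \<comment> \<open>The apex depends only on the lcm, so that all non-faces with equal lcm are
    toggled by the same index.\<close>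
  define L where "L c = (SOME l. l \<in> {1..r} \<and> strictly_divides (m l) c)" for c
  have L: "L (lcm_exp m \<sigma>) \<in> {1..r}" "strictly_divides (m (L (lcm_exp m \<sigma>))) (lcm_exp m \<sigma>)"
    if "\<sigma> \<subseteq> {1..r}" "\<sigma> \<notin> scarf_complex r m" for \<sigma>
    using assms(1)[OF that] unfolding L_def by (metis (mono_tags, lifting) someI_ex)+
  define h where
    "h \<sigma> = (if \<sigma> \<subseteq> {1..r} \<and> \<sigma> \<notin> scarf_complex r m then cone (L (lcm_exp m \<sigma>)) g \<sigma> else 0)" for \<sigma>
  have remove: "lcm_exp m (\<sigma> - {l}) = lcm_exp m \<sigma>" "\<sigma> - {l} \<notin> scarf_complex r m"
    if "l \<in> {1..r}" "strictly_divides (m l) (lcm_exp m \<sigma>)" "\<sigma> \<subseteq> {1..r}" for \<sigma> l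
  proof -
    show eq: "lcm_exp m (\<sigma> - {l}) = lcm_exp m \<sigma>"
      using that by (simp add: lcm_exp_remove_strictly_divides)
    then have "m l \<le> lcm_exp m (\<sigma> - {l} - {l})" using that by (simp add: strictly_divides_le)
    then show "\<sigma> - {l} \<notin> scarf_complex r m" using that(1) unfolding scarf_complex_iff by blast
  qed
  define g' where "g' \<sigma> = g \<sigma> - boundary r h \<sigma>" for \<sigma>
  have bd: "boundary r g' \<tau> = boundary r g \<tau>" if "\<tau> \<subseteq> {1..r}" for \<tau>
    using that by (simp add: g'_def[abs_def] boundary_diff boundary_boundary)
  have "\<tau> \<in> faces_below r m b k" if "g' \<tau> \<noteq> 0" for \<tau>
  proof (cases "g \<tau> = 0")
    case True
    \<comment> \<open>A new coefficient at \<tau> comes from a non-face \<sigma> above it with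
      \<open>g (\<sigma> - {l})\<close> non-zero, and \<open>\<sigma> - {l}\<close> has the lcm of
      \<sigma> and the size of \<tau>.\<close>
    with that have "boundary r h \<tau> \<noteq> 0" by (simp add: g'_def)
    then obtain i where i: "i \<in> {1..r}" "i \<notin> \<tau>" "h (insert i \<tau>) \<noteq> 0" by (rule boundary_nonzeroE)
    define \<sigma> where "\<sigma> = insert i \<tau>"
    define l where "l = L (lcm_exp m \<sigma>)"
    have \<sigma>: "\<sigma> \<subseteq> {1..r}" "\<sigma> \<notin> scarf_complex r m" "cone l g \<sigma> \<noteq> 0"
      using i(3) by (auto simp: h_def \<sigma>_def l_def split: if_splits)
    then have l: "l \<in> \<sigma>" "g (\<sigma> - {l}) \<noteq> 0" by (blast dest: cone_nonzero)+
    then have "lcm_exp m \<sigma> \<le> b" "card (\<sigma> - {l}) = k"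
      using Suc.prems(1)[OF l(2)] remove(1)[of l \<sigma>] L[OF \<sigma>(1,2)] \<sigma>(1)
      by (simp_all add: faces_below_def flip: l_def)
    moreover have "lcm_exp m \<tau> \<le> lcm_exp m \<sigma>" using \<sigma> by (intro lcm_exp_mono) (auto simp: \<sigma>_def)
    moreover have "card (\<sigma> - {l}) = card \<tau>"
      using finite_subset_range[OF \<sigma>(1)] i(2) l(1) by (auto simp: \<sigma>_def card_Diff_singleton_if)
    ultimately show ?thesis using \<sigma> by (auto simp: faces_below_def \<sigma>_def)
  qed (rule Suc.prems(1))
  \<comment> \<open>On non-faces of total degree at least \<open>N\<close>,
    \<open>boundary r h\<close> reproduces \<open>g\<close>; this follows from the homotopy formula
    for the single apex belonging to \<tau>.\<close>
  moreover have "(\<Sum>s\<in>UNIV. lcm_exp m \<tau> s) < N" if "g' \<tau> \<noteq> 0" "\<tau> \<notin> scarf_complex r m" for \<tau>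
  proof (rule ccontr)
    assume N: "\<not> (\<Sum>s\<in>UNIV. lcm_exp m \<tau> s) < N"
    have \<tau>: "\<tau> \<subseteq> {1..r}" using calculation[OF that(1)] by (simp add: faces_below_def)
    define l where "l = L (lcm_exp m \<tau>)"
    have l: "l \<in> {1..r}" "strictly_divides (m l) (lcm_exp m \<tau>)"
      using L[OF \<tau> that(2)] by (auto simp: l_def)
    \<comment> \<open>Around \<tau> the varying apexes act like the fixed \<open>l\<close>: an equal
      lcm selects the same apex, and a larger lcm has total degree above \<open>N\<close>, where
      \<open>g\<close> vanishes on non-faces and both cones are zero.\<close>
    have "h (insert i \<tau>) = cone l g (insert i \<tau>)" if i: "i \<in> {1..r} - \<tau>" for i
    proof -
      define \<sigma> where "\<sigma> = insert i \<tau>"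
      have \<sigma>: "\<sigma> \<subseteq> {1..r}" "\<tau> \<subseteq> \<sigma>" "\<sigma> \<notin> scarf_complex r m"
        using \<tau> i \<open>\<tau> \<notin> _\<close> scarf_complex_downward[of \<sigma> r m \<tau>] by (auto simp: \<sigma>_def)
      have le: "lcm_exp m \<tau> \<le> lcm_exp m \<sigma>" using \<sigma> by (intro lcm_exp_mono) auto
      show ?thesis
      proof (cases "lcm_exp m \<sigma> = lcm_exp m \<tau>")
        case True
        then show ?thesis using \<sigma> by (simp add: h_def l_def flip: \<sigma>_def)
      next
        case False
        then have "(\<Sum>s\<in>UNIV. lcm_exp m \<tau> s) < (\<Sum>s\<in>UNIV. lcm_exp m \<sigma> s)"
          using le by (intro sum_strict_mono_ex1) (auto simp: le_fun_def fun_eq_iff order_less_le, metis)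
        then have big: "\<not> (\<Sum>s\<in>UNIV. lcm_exp m \<sigma> s) < Suc N" using N by simp
        have "g (\<sigma> - {l'}) = 0" if "l' \<in> {1..r}" "strictly_divides (m l') (lcm_exp m \<sigma>)" for l'
          using Suc.prems(2)[of "\<sigma> - {l'}"] remove[OF that \<sigma>(1)] big by metis
        then have "cone l' g \<sigma> = 0" if "l' \<in> {1..r}" "strictly_divides (m l') (lcm_exp m \<sigma>)" for l'
          using that by (simp add: cone_def)
        then show ?thesis
          using L[OF \<sigma>(1,3)] l strictly_divides_mono[OF l(2) le] by (simp add: h_def flip: \<sigma>_def)
      qed
    qed
    then have "boundary r h \<tau> = boundary r (cone l g) \<tau>"
      by (simp add: boundary_def)
    \<comment> \<open>\<open>\<tau> - {l}\<close> is again a non-face, while the boundary of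
      \<open>g\<close> is supported on faces.\<close>
    moreover have "cone l (boundary r g) \<tau> = 0"
    proof (rule ccontr)
      assume "cone l (boundary r g) \<tau> \<noteq> 0"
      then have "boundary r g (\<tau> - {l}) \<noteq> 0" by (rule cone_nonzero)
      moreover have "\<tau> - {l} \<subseteq> {1..r}" using \<tau> by blast
      ultimately have "\<tau> - {l} \<in> scarf_complex r m" by (intro Suc.prems(3))
      then show False using remove(2)[OF l \<tau>] by simp
    qed
    ultimately have "g' \<tau> = 0"
      using boundary_cone[of \<tau> l r g] \<tau> l by (simp add: g'_def)
    then show False using that by simp
  qed
  moreover have "\<tau> \<in> scarf_complex r m" if "\<tau> \<subseteq> {1..r}" "boundary r g' \<tau> \<noteq> 0" for \<tau>
    using that Suc.prems(3) bd by simp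
  ultimately have "\<exists>g''. (\<forall>\<sigma>. g'' \<sigma> \<noteq> 0 \<longrightarrow> \<sigma> \<in> faces_below r m b k \<inter> scarf_complex r m) \<and>
    (\<forall>\<tau>\<subseteq>{1..r}. boundary r g'' \<tau> = boundary r g' \<tau>)"
    by (intro Suc.IH)
  then show ?case using bd by simp
qed

text \<open>The cone with apex \<open>l\<close> fills the cycle in the full simplex, and
  \<open>m l \<le> b\<close> keeps it in degree \<open>b\<close>. Its boundary \<open>f\<close>
  already consists of faces, so \<open>push_into_scarf_complex\<close> replaces it by a Scarf chain
  with the same boundary.\<close>

lemma scarf_complex_acyclic_below:
  fixes f :: "nat set \<Rightarrow> 'k::comm_ring_1" and m :: "nat \<Rightarrow> 'n::finite \<Rightarrow> nat"
  assumes "\<And>\<sigma>. \<sigma> \<subseteq> {1..r} \<Longrightarrow> \<sigma> \<notin> scarf_complex r m \<Longrightarrow>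
      \<exists>l\<in>{1..r}. strictly_divides (m l) (lcm_exp m \<sigma>)"
    and f: "\<And>\<sigma>. f \<sigma> \<noteq> 0 \<Longrightarrow> \<sigma> \<in> faces_below r m b k \<inter> scarf_complex r m"
    and cycle: "\<And>\<tau>. \<tau> \<subseteq> {1..r} \<Longrightarrow> boundary r f \<tau> = 0"
    and l: "l \<in> {1..r}" "m l \<le> b"
  shows "\<exists>g. (\<forall>\<sigma>. g \<sigma> \<noteq> 0 \<longrightarrow> \<sigma> \<in> faces_below r m b (Suc k) \<inter> scarf_complex r m) \<and>
    (\<forall>\<tau>\<subseteq>{1..r}. boundary r g \<tau> = f \<tau>)"
proof -
  have bd: "boundary r (cone l f) \<tau> = f \<tau>" if "\<tau> \<subseteq> {1..r}" for \<tau>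
  proof -
    have "\<tau> - {l} \<subseteq> {1..r}" using that by blast
    then show ?thesis using boundary_cone[of \<tau> l r f] that l cycle[of "\<tau> - {l}"]
      by (simp add: cone_def split: if_splits)
  qed
  \<comment> \<open>An lcm dividing \<open>b\<close> has total degree at most that of
    \<open>b\<close>; \<open>Suc\<close> makes the bound strict.\<close>
  let ?N = "Suc (\<Sum>s\<in>UNIV. b s)"
  have below: "\<sigma> \<in> faces_below r m b (Suc k)" if "cone l f \<sigma> \<noteq> 0" for \<sigma>
  proof -
    have \<sigma>: "l \<in> \<sigma>" "\<sigma> - {l} \<in> faces_below r m b k" using that f by (blast dest: cone_nonzero)+
    have sub: "\<sigma> \<subseteq> {1..r}" using \<sigma> l by (auto simp: faces_below_def)
    have "m i \<le> b" if "i \<in> \<sigma>" for i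
      using that \<sigma> l sub le_lcm_exp[of "\<sigma> - {l}" i m]
      by (cases "i = l") (auto simp: faces_below_def intro: order_trans)
    then have "lcm_exp m \<sigma> \<le> b" using sub by (simp add: lcm_exp_le_iff)
    moreover have "card \<sigma> = Suc (card (\<sigma> - {l}))" using \<sigma> sub by (metis card.remove finite_subset_range)
    ultimately show ?thesis using \<sigma> sub by (simp add: faces_below_def)
  qed
  moreover have "(\<Sum>s\<in>UNIV. lcm_exp m \<sigma> s) < ?N" if "cone l f \<sigma> \<noteq> 0" for \<sigma>
    using below[OF that] by (auto simp: faces_below_def le_fun_def less_Suc_eq_le intro!: sum_mono)
  moreover have "\<tau> \<in> scarf_complex r m" if "\<tau> \<subseteq> {1..r}" "boundary r (cone l f) \<tau> \<noteq> 0" for \<tau>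
    using that bd f by auto
  ultimately have "\<exists>g. (\<forall>\<sigma>. g \<sigma> \<noteq> 0 \<longrightarrow> \<sigma> \<in> faces_below r m b (Suc k) \<inter> scarf_complex r m) \<and>
    (\<forall>\<tau>\<subseteq>{1..r}. boundary r g \<tau> = boundary r (cone l f) \<tau>)"
    by (intro push_into_scarf_complex[where N = ?N] assms(1))
  then show ?thesis using bd by simp
qed

subsection \<open>Multigraded strands\<close>

text \<open>The value at \<open>\<sigma>\<close> is the coefficient of \<open>e\<^sub>\<sigma>\<close> in the degree \<open>b\<close> component of \<open>v\<close>.\<close>

definition strand ::
    "(nat \<Rightarrow> 'n \<Rightarrow> nat) \<Rightarrow> ('n \<Rightarrow> nat) \<Rightarrow> (nat set \<Rightarrow>\<^sub>0 ('n, 'k::zero) mpoly) \<Rightarrow> nat set \<Rightarrow> 'k" where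
  "strand m b v \<sigma> = (if lcm_exp m \<sigma> \<le> b
     then Poly_Mapping.lookup (Poly_Mapping.lookup v \<sigma>) (b - lcm_exp m \<sigma>) else 0)"

lemma exponent_add_diff [simp]: "(u + a) - a = (u :: 'n \<Rightarrow> nat)" "a \<le> u + a"
  by (auto simp: fun_eq_iff le_fun_def)

lemma exponent_diff_add: "a \<le> b \<Longrightarrow> (b - a) + a = (b :: 'n \<Rightarrow> nat)"
  by (auto simp: fun_eq_iff le_fun_def)

lemma strand_add [simp]: "strand m (u + lcm_exp m \<sigma>) v \<sigma> = Poly_Mapping.lookup (Poly_Mapping.lookup v \<sigma>) u"
  by (simp add: strand_def)

text \<open>Every exponent \<open>u\<close> in the coefficient of \<open>e\<^sub>\<sigma>\<close> is
  seen in the strand of degree \<open>u + lcm_exp m \<sigma>\<close>.\<close>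

lemma strand_eqI: "(\<And>b \<sigma>. strand m b v \<sigma> = strand m b w \<sigma>) \<Longrightarrow> v = w"
  by (intro poly_mapping_eqI) (metis strand_add)

lemma strand_nonzero:
  assumes "strand m b v \<sigma> \<noteq> 0"
  shows "\<sigma> \<in> Poly_Mapping.keys v" "lcm_exp m \<sigma> \<le> b"
  using assms by (auto simp: strand_def in_keys_iff split: if_splits)

lemma homogeneous_vec_iff_strand:
  "homogeneous_vec (lcm_exp m) a v \<longleftrightarrow> (\<forall>b \<sigma>. b \<noteq> a \<longrightarrow> strand m b v \<sigma> = 0)"
proof (intro iffI allI impI)
  fix b \<sigma> assume H: "homogeneous_vec (lcm_exp m) a v" "b \<noteq> a"
  show "strand m b v \<sigma> = 0"
  proof (rule ccontr)
    assume "strand m b v \<sigma> \<noteq> 0"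
    then have "lcm_exp m \<sigma> \<le> b" "b - lcm_exp m \<sigma> \<in> Poly_Mapping.keys (Poly_Mapping.lookup v \<sigma>)"
      by (auto simp: strand_def in_keys_iff split: if_splits)
    moreover from this have "b - lcm_exp m \<sigma> + lcm_exp m \<sigma> = a"
      using H(1) unfolding homogeneous_vec_def by blast
    ultimately show False using H(2) by (simp add: exponent_diff_add)
  qed
next
  assume H: "\<forall>b \<sigma>. b \<noteq> a \<longrightarrow> strand m b v \<sigma> = 0"
  show "homogeneous_vec (lcm_exp m) a v"
    unfolding homogeneous_vec_def
  proof (intro allI subsetI CollectI)
    fix \<sigma> u assume "u \<in> Poly_Mapping.keys (Poly_Mapping.lookup v \<sigma>)"
    then have "strand m (u + lcm_exp m \<sigma>) v \<sigma> \<noteq> 0" by (simp add: in_keys_iff)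
    then show "u + lcm_exp m \<sigma> = a" using H by blast
  qed
qed

lemma sum_single_lookup:
  "(\<Sum>a\<in>Poly_Mapping.keys p. Poly_Mapping.single a (Poly_Mapping.lookup p a)) = p"
  by (intro poly_mapping_eqI) (simp add: lookup_sum lookup_single when_def sum.delta in_keys_iff)

lemma lookup_mult_single:
  fixes p :: "('n, 'k::comm_ring_1) mpoly"
  shows "Poly_Mapping.lookup (p * Poly_Mapping.single u c) w =
    (if u \<le> w then Poly_Mapping.lookup p (w - u) * c else 0)"
proof -
  have eq: "a + u = w \<longleftrightarrow> u \<le> w \<and> a = w - u" for a
    by (auto simp: exponent_diff_add)
  have "p * Poly_Mapping.single u c =
      (\<Sum>a\<in>Poly_Mapping.keys p. Poly_Mapping.single (a + u) (Poly_Mapping.lookup p a * c))"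
    by (subst sum_single_lookup[of p, symmetric]) (simp add: sum_distrib_right mult_single)
  then have "Poly_Mapping.lookup (p * Poly_Mapping.single u c) w =
      (\<Sum>a\<in>Poly_Mapping.keys p. if a = w - u then (if u \<le> w then Poly_Mapping.lookup p a * c else 0) else 0)"
    by (simp add: lookup_sum lookup_single eq when_def conj_commute if_if_eq_conj)
  then show ?thesis by (simp add: sum.delta in_keys_iff)
qed

text \<open>Turns the sum over basis elements and their facets into a sum over the sets covering a
  fixed \<tau>, which is the shape of \<open>boundary\<close>.\<close>

lemma lookup_scarf_differential:
  fixes v :: "nat set \<Rightarrow>\<^sub>0 ('n, 'k::comm_ring_1) mpoly"
  assumes v: "v \<in> free_module B" "B \<subseteq> Pow {1..r}"
  shows "Poly_Mapping.lookup (scarf_differential m v) \<tau> =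
    (\<Sum>i\<in>{1..r} - \<tau>. Poly_Mapping.lookup v (insert i \<tau>) *
      Poly_Mapping.single (lcm_exp m (insert i \<tau>) - lcm_exp m \<tau>) (face_sign i (insert i \<tau>)))"
proof -
  let ?c = "\<lambda>\<sigma> i. Poly_Mapping.lookup v \<sigma> *
    Poly_Mapping.single (lcm_exp m \<sigma> - lcm_exp m (\<sigma> - {i})) (face_sign i \<sigma>)"
  have keys: "Poly_Mapping.keys v \<subseteq> Pow {1..r}" using v by (auto simp: free_module_def)
  have "Poly_Mapping.lookup (scarf_differential m v) \<tau> =
      (\<Sum>\<sigma>\<in>Poly_Mapping.keys v. \<Sum>i\<in>\<sigma>. ?c \<sigma> i when \<sigma> - {i} = \<tau>)"
    by (simp add: scarf_differential_def lookup_sum scarf_boundary_def sum_distrib_left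
      lookup_single mult_when)
  also have "\<dots> = (\<Sum>\<sigma>\<in>Pow {1..r}. \<Sum>i\<in>\<sigma>. ?c \<sigma> i when \<sigma> - {i} = \<tau>)"
    using keys by (intro sum.mono_neutral_left) (auto simp: in_keys_iff)
  also have "\<dots> = (\<Sum>(\<sigma>, i)\<in>Sigma (Pow {1..r}) (\<lambda>\<sigma>. \<sigma>). ?c \<sigma> i when \<sigma> - {i} = \<tau>)"
    by (intro sum.Sigma) auto
  \<comment> \<open>Neither index set need contain the other: extra pairs on the left have
    \<open>\<sigma> - {i}\<close> different from \<tau>, and extra pairs on the right have
    \<open>insert i \<tau>\<close> outside \<open>{1..r}\<close> and hence coefficient zero.\<close>
  also have "\<dots> = (\<Sum>(\<sigma>, i)\<in>(\<lambda>i. (insert i \<tau>, i)) ` ({1..r} - \<tau>). ?c \<sigma> i)"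
  proof (intro sum.mono_neutral_cong finite_SigmaI)
    fix p assume p: "p \<in> (\<lambda>i. (insert i \<tau>, i)) ` ({1..r} - \<tau>) - Sigma (Pow {1..r}) (\<lambda>\<sigma>. \<sigma>)"
    then have "Poly_Mapping.lookup v (fst p) = 0"
      using keys by (auto simp: in_keys_iff)
    then show "(case p of (\<sigma>, i) \<Rightarrow> ?c \<sigma> i) = 0" by (simp add: case_prod_beta)
  next
    fix p assume p: "p \<in> Sigma (Pow {1..r}) (\<lambda>\<sigma>. \<sigma>) - (\<lambda>i. (insert i \<tau>, i)) ` ({1..r} - \<tau>)"
    obtain \<sigma> i where [simp]: "p = (\<sigma>, i)" by (cases p)
    have "\<sigma> - {i} \<noteq> \<tau>"
    proof
      assume "\<sigma> - {i} = \<tau>"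
      then have "\<sigma> = insert i \<tau>" "i \<in> {1..r} - \<tau>" using p by auto
      then show False using p by auto
    qed
    then show "(case p of (\<sigma>, i) \<Rightarrow> ?c \<sigma> i when \<sigma> - {i} = \<tau>) = 0" by simp
  qed (auto simp: when_def)
  also have "\<dots> = (\<Sum>i\<in>{1..r} - \<tau>. ?c (insert i \<tau>) i)"
    by (subst sum.reindex) (auto simp: inj_on_def)
  finally show ?thesis by simp
qed

text \<open>The monomial quotient in the differential is exactly the shift between the degree
  \<open>b\<close> strands at \<open>insert i \<tau>\<close> and at \<tau>, so only the signs
  remain. Questions about the Scarf complex thereby become questions about simplicial
  chains.\<close>

lemma strand_scarf_differential:
  fixes v :: "nat set \<Rightarrow>\<^sub>0 ('n, 'k::comm_ring_1) mpoly"
  assumes v: "v \<in> free_module B" "B \<subseteq> Pow {1..r}" and \<tau>: "finite \<tau>"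
  shows "strand m b (scarf_differential m v) \<tau> = boundary r (strand m b v) \<tau>"
proof -
  have "Poly_Mapping.lookup (Poly_Mapping.lookup v (insert i \<tau>) *
        Poly_Mapping.single (lcm_exp m (insert i \<tau>) - lcm_exp m \<tau>) (face_sign i (insert i \<tau>)))
        (b - lcm_exp m \<tau>) = face_sign i (insert i \<tau>) * strand m b v (insert i \<tau>)"
    if "lcm_exp m \<tau> \<le> b" for i
  proof -
    have le: "lcm_exp m \<tau> s \<le> lcm_exp m (insert i \<tau>) s" "lcm_exp m \<tau> s \<le> b s" for s
      using that \<tau> lcm_exp_mono[of "insert i \<tau>" \<tau> m] by (auto simp: le_fun_def)
    have "lcm_exp m (insert i \<tau>) - lcm_exp m \<tau> \<le> b - lcm_exp m \<tau> \<longleftrightarrow> lcm_exp m (insert i \<tau>) \<le> b"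
      using le by (auto simp: le_fun_def le_diff_iff)
    moreover have "b - lcm_exp m \<tau> - (lcm_exp m (insert i \<tau>) - lcm_exp m \<tau>) = b - lcm_exp m (insert i \<tau>)"
      using le by (auto simp: fun_eq_iff)
    ultimately show ?thesis by (simp add: lookup_mult_single strand_def mult.commute)
  qed
  \<comment> \<open>If the lcm of \<tau> does not divide \<open>b\<close>, neither does that of a
    larger set, so both sides vanish.\<close>
  moreover have "strand m b v (insert i \<tau>) = 0" if "\<not> lcm_exp m \<tau> \<le> b" for i
    using that \<tau> order_trans[OF lcm_exp_mono[of "insert i \<tau>" \<tau> m]] by (auto simp: strand_def)
  ultimately show ?thesis
    unfolding boundary_def strand_def[of m b "scarf_differential m v"]
      lookup_scarf_differential[OF v] lookup_sum by simp
qed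

text \<open>The inverse of \<open>v \<mapsto> (\<lambda>b. strand m b v)\<close>.\<close>

definition assemble ::
    "nat \<Rightarrow> (nat \<Rightarrow> 'n \<Rightarrow> nat) \<Rightarrow> ('n \<Rightarrow> nat) set \<Rightarrow> (('n \<Rightarrow> nat) \<Rightarrow> nat set \<Rightarrow> 'k::comm_monoid_add) \<Rightarrow>
      nat set \<Rightarrow>\<^sub>0 ('n, 'k) mpoly" where
  "assemble r m D g = (\<Sum>b\<in>D. \<Sum>\<sigma>\<in>Pow {1..r}.
     Poly_Mapping.single \<sigma> (Poly_Mapping.single (b - lcm_exp m \<sigma>) (g b \<sigma>)))"

lemma strand_assemble:
  fixes g :: "('n \<Rightarrow> nat) \<Rightarrow> nat set \<Rightarrow> 'k::comm_monoid_add"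
  assumes D: "finite D"
    and g: "\<And>b \<sigma>. b \<in> D \<Longrightarrow> g b \<sigma> \<noteq> 0 \<Longrightarrow> \<sigma> \<subseteq> {1..r} \<and> lcm_exp m \<sigma> \<le> b"
  shows "strand m b (assemble r m D g) \<sigma> = (if b \<in> D then g b \<sigma> else 0)"
proof -
  have "Poly_Mapping.lookup (assemble r m D g) \<sigma> =
      (\<Sum>c\<in>D. \<Sum>\<tau>\<in>Pow {1..r}. Poly_Mapping.single (c - lcm_exp m \<sigma>) (g c \<sigma>) when \<tau> = \<sigma>)"
    by (auto simp: assemble_def lookup_sum lookup_single when_def intro!: sum.cong)
  also have "\<dots> = (\<Sum>c\<in>D. Poly_Mapping.single (c - lcm_exp m \<sigma>) (g c \<sigma>))"
  proof (intro sum.cong refl)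
    fix c assume "c \<in> D"
    show "(\<Sum>\<tau>\<in>Pow {1..r}. Poly_Mapping.single (c - lcm_exp m \<sigma>) (g c \<sigma>) when \<tau> = \<sigma>) =
        Poly_Mapping.single (c - lcm_exp m \<sigma>) (g c \<sigma>)"
    proof (cases "g c \<sigma> = 0")
      case False
      then have "\<sigma> \<in> Pow {1..r}" using g \<open>c \<in> D\<close> by blast
      then show ?thesis unfolding when_def by (subst sum.delta) auto
    qed simp
  qed
  finally have *: "Poly_Mapping.lookup (assemble r m D g) \<sigma> = \<dots>" .
  show ?thesis
  proof (cases "lcm_exp m \<sigma> \<le> b")
    case True
    have "(g c \<sigma> when c - lcm_exp m \<sigma> = b - lcm_exp m \<sigma>) = (if c = b then g b \<sigma> else 0)" if "c \<in> D" for c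
    proof (cases "g c \<sigma> = 0")
      case False
      then have "lcm_exp m \<sigma> \<le> c" using g that by blast
      \<comment> \<open>Truncated subtraction of the lcm is injective on the degrees it
        divides.\<close>
      then have "c - lcm_exp m \<sigma> = b - lcm_exp m \<sigma> \<longleftrightarrow> c = b"
        using True by (metis exponent_diff_add)
      then show ?thesis by (simp add: when_def)
    qed auto
    then show ?thesis using True D by (simp add: strand_def * lookup_sum lookup_single)
  next
    case False
    then show ?thesis using g by (auto simp: strand_def)
  qed
qed

lemma in_free_module_iff: "v \<in> free_module B \<longleftrightarrow> (\<forall>\<sigma>. \<sigma> \<notin> B \<longrightarrow> Poly_Mapping.lookup v \<sigma> = 0)"
  by (auto simp: free_module_def in_keys_iff)

lemma free_module_strandI:
  assumes "\<And>b \<sigma>. strand m b v \<sigma> \<noteq> 0 \<Longrightarrow> \<sigma> \<in> B"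
  shows "v \<in> free_module B"
  unfolding in_free_module_iff
proof (intro allI impI, rule ccontr)
  fix \<sigma> assume "\<sigma> \<notin> B" "Poly_Mapping.lookup v \<sigma> \<noteq> 0"
  then obtain u where "Poly_Mapping.lookup (Poly_Mapping.lookup v \<sigma>) u \<noteq> 0"
    by (auto simp: poly_mapping_eq_iff fun_eq_iff)
  then have "strand m (u + lcm_exp m \<sigma>) v \<sigma> \<noteq> 0" by simp
  then have "\<sigma> \<in> B" by (rule assms)
  then show False using \<open>\<sigma> \<notin> B\<close> by contradiction
qed

lemma free_module_strandD: "v \<in> free_module B \<Longrightarrow> strand m b v \<sigma> \<noteq> 0 \<Longrightarrow> \<sigma> \<in> B"
  by (auto simp: free_module_def dest: strand_nonzero(1))

lemma strand_zero [simp]: "strand m b 0 \<sigma> = 0"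
  by (simp add: strand_def)

text \<open>Finitely many basis elements with finitely many exponents each; this lets
  \<open>assemble\<close> rebuild an element from chains chosen degree by degree.\<close>

lemma finite_strands: "finite {b. \<exists>\<sigma>. strand m b v \<sigma> \<noteq> 0}"
proof (rule finite_subset)
  show "{b. \<exists>\<sigma>. strand m b v \<sigma> \<noteq> 0} \<subseteq> (\<Union>\<sigma>\<in>Poly_Mapping.keys v.
      (\<lambda>u. u + lcm_exp m \<sigma>) ` Poly_Mapping.keys (Poly_Mapping.lookup v \<sigma>))"
  proof clarify
    fix b \<sigma> assume s: "strand m b v \<sigma> \<noteq> 0"
    then have "b - lcm_exp m \<sigma> \<in> Poly_Mapping.keys (Poly_Mapping.lookup v \<sigma>)"
      by (auto simp: strand_def in_keys_iff split: if_splits)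
    moreover have "b = b - lcm_exp m \<sigma> + lcm_exp m \<sigma>"
      using strand_nonzero(2)[OF s] by (simp add: exponent_diff_add)
    ultimately show "b \<in> (\<Union>\<sigma>\<in>Poly_Mapping.keys v.
        (\<lambda>u. u + lcm_exp m \<sigma>) ` Poly_Mapping.keys (Poly_Mapping.lookup v \<sigma>))"
      using strand_nonzero(1)[OF s] by blast
  qed
qed auto

section \<open>The Scarf differential on free modules\<close>

lemma scarf_basis_subset: "scarf_basis r m k \<subseteq> Pow {1..r}"
  using scarf_complex_subset by (auto simp: scarf_basis_def)

lemma finite_scarf_basis: "\<sigma> \<in> scarf_basis r m k \<Longrightarrow> finite \<sigma>"
  using scarf_basis_subset finite_subset_range by blast

lemma scarf_differential_add:
  fixes v w :: "nat set \<Rightarrow>\<^sub>0 ('n, 'k::comm_ring_1) mpoly"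
  assumes "B \<subseteq> Pow {1..r}" "v \<in> free_module B" "w \<in> free_module B"
  shows "scarf_differential m (v + w) = scarf_differential m v + scarf_differential m w"
proof -
  have "v + w \<in> free_module B" using assms by (auto simp: in_free_module_iff lookup_add)
  then show ?thesis using assms(2,3)
    by (intro poly_mapping_eqI)
      (simp add: lookup_scarf_differential[OF _ assms(1)] lookup_add distrib_right sum.distrib)
qed

lemma scarf_differential_smult:
  fixes v :: "nat set \<Rightarrow>\<^sub>0 ('n, 'k::comm_ring_1) mpoly"
  assumes "B \<subseteq> Pow {1..r}" "v \<in> free_module B"
  shows "scarf_differential m (smult c v) = smult c (scarf_differential m v)"
proof -
  have "smult c v \<in> free_module B" using assms by (auto simp: in_free_module_iff)
  then show ?thesis using assms(2)
    by (intro poly_mapping_eqI)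
      (simp add: lookup_scarf_differential[OF _ assms(1)] mult.assoc sum_distrib_left)
qed

lemma scarf_differential_in_free_module:
  fixes v :: "nat set \<Rightarrow>\<^sub>0 ('n, 'k::comm_ring_1) mpoly"
  assumes v: "v \<in> free_module (scarf_basis r m (Suc k))"
  shows "scarf_differential m v \<in> free_module (scarf_basis r m k)"
  unfolding in_free_module_iff
proof (intro allI impI, rule ccontr)
  fix \<tau> assume \<tau>: "\<tau> \<notin> scarf_basis r m k" "Poly_Mapping.lookup (scarf_differential m v) \<tau> \<noteq> 0"
  from \<tau>(2) obtain i where "i \<notin> \<tau>" "Poly_Mapping.lookup v (insert i \<tau>) \<noteq> 0"
    unfolding lookup_scarf_differential[OF v scarf_basis_subset]
    by (metis (no_types, lifting) DiffE mult_zero_left sum.neutral)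
  moreover from this have face: "insert i \<tau> \<in> scarf_complex r m" "card (insert i \<tau>) = Suc k"
    using v unfolding in_free_module_iff scarf_basis_def by blast+
  moreover have "finite (insert i \<tau>)" using face(1) scarf_complex_subset by blast
  ultimately have "\<tau> \<in> scarf_basis r m k"
    using scarf_complex_downward[of "insert i \<tau>" r m \<tau>] by (auto simp: scarf_basis_def)
  then show False using \<tau>(1) by contradiction
qed

text \<open>Strandwise this is \<open>boundary_boundary\<close>; infinite index sets, which the type
  admits, carry no coefficient.\<close>

lemma scarf_differential_differential:
  fixes v :: "nat set \<Rightarrow>\<^sub>0 ('n, 'k::comm_ring_1) mpoly"
  assumes v: "v \<in> free_module (scarf_basis r m (Suc (Suc k)))"
  shows "scarf_differential m (scarf_differential m v) = 0"
proof (rule strand_eqI)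
  fix b \<tau>
  note dv = scarf_differential_in_free_module[OF v]
  note ddv = scarf_differential_in_free_module[OF dv]
  show "strand m b (scarf_differential m (scarf_differential m v)) \<tau> = strand m b 0 \<tau>"
  proof (cases "finite \<tau>")
    case True
    have "strand m b (scarf_differential m (scarf_differential m v)) \<tau> =
        boundary r (strand m b (scarf_differential m v)) \<tau>"
      by (rule strand_scarf_differential[OF dv scarf_basis_subset True])
    also have "\<dots> = boundary r (boundary r (strand m b v)) \<tau>"
      unfolding boundary_def[of r _ \<tau>] using True
      by (simp add: strand_scarf_differential[OF v scarf_basis_subset])
    also have "\<dots> = 0" using True by (rule boundary_boundary)
    finally show ?thesis by simp
  next
    case False
    then have "\<tau> \<notin> scarf_basis r m k" using finite_scarf_basis by blast
    then show ?thesis using free_module_strandD[OF ddv, of m b \<tau>] by auto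
  qed
qed

text \<open>Each strand of the cycle is filled by \<open>scarf_complex_acyclic_below\<close>, and
  the fillings in the finitely many degrees \<open>D\<close> are assembled into one preimage. The
  last assumption restricts \<open>v\<close> to degrees of monomials in the ideal, which supplies
  the cone apex.\<close>

lemma scarf_exact:
  fixes v :: "nat set \<Rightarrow>\<^sub>0 ('n::finite, 'k::comm_ring_1) mpoly"
  assumes ex: "\<And>\<sigma>. \<sigma> \<subseteq> {1..r} \<Longrightarrow> \<sigma> \<notin> scarf_complex r m \<Longrightarrow>
      \<exists>l\<in>{1..r}. strictly_divides (m l) (lcm_exp m \<sigma>)"
    and v: "v \<in> free_module (scarf_basis r m k)"
    and cycle: "scarf_differential m v = 0"
    and l: "\<And>b \<sigma>. strand m b v \<sigma> \<noteq> 0 \<Longrightarrow> \<exists>l\<in>{1..r}. m l \<le> b"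
  shows "v \<in> scarf_differential m ` free_module (scarf_basis r m (Suc k))"
proof -
  define D where "D = {b. \<exists>\<sigma>. strand m b v \<sigma> \<noteq> 0}"
  have "\<exists>g. (\<forall>\<sigma>. g \<sigma> \<noteq> 0 \<longrightarrow> \<sigma> \<in> faces_below r m b (Suc k) \<inter> scarf_complex r m) \<and>
      (\<forall>\<tau>\<subseteq>{1..r}. boundary r g \<tau> = strand m b v \<tau>)" if b: "b \<in> D" for b
  proof -
    obtain \<sigma> where "strand m b v \<sigma> \<noteq> 0" using b unfolding D_def by blast
    then obtain j where j: "j \<in> {1..r}" "m j \<le> b" using l by blast
    show ?thesis
    proof (rule scarf_complex_acyclic_below[OF ex _ _ j])
      fix \<sigma> assume s: "strand m b v \<sigma> \<noteq> 0"
      then show "\<sigma> \<in> faces_below r m b k \<inter> scarf_complex r m"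
        using free_module_strandD[OF v s] strand_nonzero(2)[OF s] scarf_complex_subset
        by (auto simp: scarf_basis_def faces_below_def)
    next
      fix \<tau> assume "\<tau> \<subseteq> {1..r}"
      then show "boundary r (strand m b v) \<tau> = 0"
        using strand_scarf_differential[OF v scarf_basis_subset, of \<tau> m b] cycle by simp
    qed
  qed
  then obtain g where g: "\<And>b \<sigma>. b \<in> D \<Longrightarrow> g b \<sigma> \<noteq> 0 \<Longrightarrow> \<sigma> \<in> faces_below r m b (Suc k) \<inter> scarf_complex r m"
      "\<And>b \<tau>. b \<in> D \<Longrightarrow> \<tau> \<subseteq> {1..r} \<Longrightarrow> boundary r (g b) \<tau> = strand m b v \<tau>"
    by metis
  define w where "w = assemble r m D g"
  have sw: "strand m b w \<sigma> = (if b \<in> D then g b \<sigma> else 0)" for b \<sigma>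
    unfolding w_def using g(1) finite_strands
    by (intro strand_assemble) (auto simp: D_def faces_below_def)
  have w: "w \<in> free_module (scarf_basis r m (Suc k))"
  proof (rule free_module_strandI)
    fix b \<sigma> assume "strand m b w \<sigma> \<noteq> 0"
    then have "\<sigma> \<in> faces_below r m b (Suc k) \<inter> scarf_complex r m"
      using g(1) by (auto simp: sw split: if_splits)
    then show "\<sigma> \<in> scarf_basis r m (Suc k)" by (simp add: scarf_basis_def faces_below_def)
  qed
  have "scarf_differential m w = v"
  proof (rule strand_eqI)
    fix b \<tau>
    show "strand m b (scarf_differential m w) \<tau> = strand m b v \<tau>"
    proof (cases "\<tau> \<subseteq> {1..r}")
      case True
      have "boundary r (strand m b w) \<tau> = strand m b v \<tau>"
      proof (cases "b \<in> D")
        case True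
        then have "strand m b w = g b" by (simp add: sw fun_eq_iff)
        then show ?thesis using g(2) True \<open>\<tau> \<subseteq> _\<close> by simp
      next
        case False
        then have "strand m b v \<tau> = 0" by (simp add: D_def)
        then show ?thesis using False by (simp add: boundary_def sw)
      qed
      then show ?thesis using strand_scarf_differential[OF w scarf_basis_subset] True by simp
    next
      case False
      then have "\<tau> \<notin> scarf_basis r m k" using scarf_basis_subset by blast
      then show ?thesis
        using free_module_strandD[OF v, of m b \<tau>]
          free_module_strandD[OF scarf_differential_in_free_module[OF w], of m b \<tau>] by metis
    qed
  qed
  then show ?thesis using w by blast
qed

subsection \<open>Monomial ideals\<close>

text \<open>Divisibility passes to multiples, so the right side is closed under the ideal
  operations; conversely each term of \<open>f\<close> is a multiple of a generator. The arbitrary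
  index set \<open>J\<close> lets one description serve \<open>M\<close>, its smaller generating
  sets and the ideal of the variables.\<close>

lemma ideal_monom:
  fixes m :: "'i \<Rightarrow> 'n \<Rightarrow> nat"
  shows "ideal {monom (m j) | j. j \<in> J} =
    {f :: ('n, 'k::comm_ring_1) mpoly. \<forall>b\<in>Poly_Mapping.keys f. \<exists>j\<in>J. m j \<le> b}"
    (is "_ = ?R")
proof -
  interpret S: module "(*) :: ('n, 'k) mpoly \<Rightarrow> _" by (rule module_mult)
  show ?thesis
  proof
    have subspace: "S.subspace ?R"
    proof (rule S.subspaceI)
      fix f g :: "('n, 'k) mpoly" assume "f \<in> ?R" "g \<in> ?R"
      then show "f + g \<in> ?R" using keys_add[of f g] by blast
    next
      fix c f :: "('n, 'k) mpoly" assume f: "f \<in> ?R"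
      show "c * f \<in> ?R"
      proof safe
        fix b assume "b \<in> Poly_Mapping.keys (c * f)"
        then obtain a a' where a: "a' \<in> Poly_Mapping.keys f" "b = a + a'"
          using keys_mult[of c f] by blast
        then obtain j where "j \<in> J" "m j \<le> a'" using f by blast
        moreover have "a' \<le> b" using a by simp
        ultimately show "\<exists>j\<in>J. m j \<le> b" using order_trans by blast
      qed
    qed simp
    have gens: "{monom (m j) | j. j \<in> J} \<subseteq> ?R"
    proof
      fix f :: "('n, 'k) mpoly" assume "f \<in> {monom (m j) | j. j \<in> J}"
      then obtain j where j: "j \<in> J" "f = monom (m j)" by blast
      then have "b = m j" if "b \<in> Poly_Mapping.keys f" for b
        using that by (simp add: monom_def split: if_splits)
      then show "f \<in> ?R" using j(1) by auto
    qed
    show "ideal {monom (m j) | j. j \<in> J} \<subseteq> ?R"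
      unfolding ideal_def by (rule S.span_minimal[OF gens subspace])
  next
    let ?I = "S.span {monom (m j) | j. j \<in> J}"
    have "f \<in> ?I" if f: "\<forall>b\<in>Poly_Mapping.keys f. \<exists>j\<in>J. m j \<le> b" for f
    proof -
      have "Poly_Mapping.single b (Poly_Mapping.lookup f b) \<in> ?I" if b: "b \<in> Poly_Mapping.keys f" for b
      proof -
        obtain j where j: "j \<in> J" "m j \<le> b" using bspec[OF f b] by (elim bexE)
        have "monom (m j) \<in> ?I" by (rule S.span_base) (use j(1) in blast)
        then have "Poly_Mapping.single (b - m j) (Poly_Mapping.lookup f b) * monom (m j) \<in> ?I"
          by (rule S.span_scale)
        then show ?thesis using j(2) by (simp add: monom_def mult_single exponent_diff_add)
      qed
      then have "(\<Sum>b\<in>Poly_Mapping.keys f. Poly_Mapping.single b (Poly_Mapping.lookup f b)) \<in> ?I"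
        by (rule S.span_sum)
      then show ?thesis by (simp only: sum_single_lookup)
    qed
    then show "?R \<subseteq> ideal {monom (m j) | j. j \<in> J}" unfolding ideal_def by (intro subsetI) simp
  qed
qed

text \<open>Otherwise dropping \<open>m j\<close> would leave the same set of divisible monomials,
  hence the same ideal, against minimality.\<close>

lemma minimal_monomial_generators_incomparable:
  fixes M :: "('n, 'k::comm_ring_1) mpoly set"
  assumes min: "minimal_monomial_generators M r m"
    and ij: "i \<in> {1..r}" "j \<in> {1..r}" "i \<noteq> j"
  shows "\<not> m i \<le> m j"
proof
  assume le: "m i \<le> m j"
  have "(\<exists>l\<in>{1..r}. m l \<le> b) \<longleftrightarrow> (\<exists>l\<in>{l \<in> {1..r}. l \<noteq> j}. m l \<le> b)" for b
    using ij le order_trans by blast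
  then have "ideal {monom (m l) | l. l \<in> {l \<in> {1..r}. l \<noteq> j}} =
      (ideal {monom (m l) | l. l \<in> {1..r}} :: ('n, 'k) mpoly set)"
    unfolding ideal_monom by simp
  then show False using min ij by (auto simp: minimal_monomial_generators_def)
qed

lemma single_in_maximal_ideal:
  assumes "u \<noteq> 0"
  shows "Poly_Mapping.single u c \<in> (ideal (range var) :: ('n, 'k::comm_ring_1) mpoly set)"
proof -
  obtain s where "u s \<noteq> 0" using assms by (auto simp: fun_eq_iff)
  then have "(\<lambda>t. if t = s then 1 else 0) \<le> u" by (auto simp: le_fun_def)
  moreover have "range (var :: 'n \<Rightarrow> ('n, 'k) mpoly) = {monom (\<lambda>t. if t = s then 1 else 0) | s. s \<in> UNIV}"
    by (auto simp: var_def)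
  moreover have "(ideal {monom (\<lambda>t. if t = s then 1 else 0) | s. s \<in> UNIV} :: ('n, 'k) mpoly set) =
      {f. \<forall>b\<in>Poly_Mapping.keys f. \<exists>s\<in>UNIV. (\<lambda>t. if t = s then 1 else 0) \<le> b}"
    by (rule ideal_monom)
  ultimately show ?thesis by (simp split: if_splits) blast
qed

lemma residue_class_eq_iff:
  assumes "M = ideal X"
  shows "residue_class M f = residue_class M g \<longleftrightarrow> f - g \<in> M"
proof -
  interpret S: module "(*) :: 'a \<Rightarrow> 'a \<Rightarrow> 'a" by (rule module_mult)
  have M: "M = S.span X" using assms by (simp add: ideal_def)
  show ?thesis
  proof
    assume "residue_class M f = residue_class M g"
    moreover have "f \<in> residue_class M f" by (simp add: residue_class_def M S.span_zero)
    ultimately show "f - g \<in> M" by (simp add: residue_class_def)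
  next
    assume fg: "f - g \<in> M"
    have "h - f \<in> M \<longleftrightarrow> h - g \<in> M" for h
    proof
      assume "h - f \<in> M"
      then have "(h - f) + (f - g) \<in> M" using fg unfolding M by (rule S.span_add)
      then show "h - g \<in> M" by simp
    next
      assume "h - g \<in> M"
      then have "(h - g) - (f - g) \<in> M" using fg unfolding M by (rule S.span_diff)
      then show "h - f \<in> M" by simp
    qed
    then show "residue_class M f = residue_class M g" by (simp add: residue_class_def)
  qed
qed

subsection \<open>Genericity and the Scarf resolution\<close>

text \<open>The empty face sits in degree 0, so reading off its coefficient modulo \<open>M\<close>
  preserves degrees.\<close>

lemma augmentation_graded_hom:
  fixes M :: "('n, 'k::comm_ring_1) mpoly set"
  assumes "M = ideal X"
  shows "graded_hom_to_quotient (lcm_exp m) B M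
    (\<lambda>v :: nat set \<Rightarrow>\<^sub>0 ('n, 'k) mpoly. residue_class M (Poly_Mapping.lookup v {}))"
proof -
  interpret S: module "(*) :: ('n, 'k) mpoly \<Rightarrow> _" by (rule module_mult)
  have M: "M = S.span X" using assms by (simp add: ideal_def)
  show ?thesis
    unfolding graded_hom_to_quotient_def residue_class_eq_iff[OF assms]
  proof (intro conjI allI ballI impI; (elim conjE)?)
    fix u v :: "nat set \<Rightarrow>\<^sub>0 ('n, 'k) mpoly" and f g
    assume "Poly_Mapping.lookup u {} - f \<in> M" "Poly_Mapping.lookup v {} - g \<in> M"
    then have "(Poly_Mapping.lookup u {} - f) + (Poly_Mapping.lookup v {} - g) \<in> M"
      unfolding M by (rule S.span_add)
    then show "Poly_Mapping.lookup (u + v) {} - (f + g) \<in> M"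
      by (simp add: lookup_add algebra_simps)
  next
    fix c f and v :: "nat set \<Rightarrow>\<^sub>0 ('n, 'k) mpoly" assume "Poly_Mapping.lookup v {} - f \<in> M"
    then have "c * (Poly_Mapping.lookup v {} - f) \<in> M" unfolding M by (rule S.span_scale)
    then show "Poly_Mapping.lookup (smult c v) {} - c * f \<in> M" by (simp add: algebra_simps)
  next
    fix a and v :: "nat set \<Rightarrow>\<^sub>0 ('n, 'k) mpoly" assume "homogeneous_vec (lcm_exp m) a v"
    then have "Poly_Mapping.keys (Poly_Mapping.lookup v {}) \<subseteq> {u. u + lcm_exp m {} = a}"
      unfolding homogeneous_vec_def by blast
    then have "homogeneous a (Poly_Mapping.lookup v {})" by (auto simp: homogeneous_def)
    moreover have "Poly_Mapping.lookup v {} - Poly_Mapping.lookup v {} \<in> M"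
      by (simp add: M S.span_zero)
    ultimately show "\<exists>f. homogeneous a f \<and> Poly_Mapping.lookup v {} - f \<in> M" by blast
  qed auto
qed

lemma scarf_differential_graded_hom:
  "graded_hom (lcm_exp m) (scarf_basis r m (Suc k)) (scarf_basis r m k)
    (scarf_differential m :: _ \<Rightarrow> nat set \<Rightarrow>\<^sub>0 ('n, 'k::comm_ring_1) mpoly)"
  unfolding graded_hom_def
proof (intro conjI ballI allI impI)
  note sub = scarf_basis_subset[of r m]
  fix a and v :: "nat set \<Rightarrow>\<^sub>0 ('n, 'k) mpoly"
  assume v: "v \<in> free_module (scarf_basis r m (Suc k))" "homogeneous_vec (lcm_exp m) a v"
  show "homogeneous_vec (lcm_exp m) a (scarf_differential m v)"
    unfolding homogeneous_vec_iff_strand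
  proof (intro allI impI)
    fix b \<tau> assume b: "b \<noteq> a"
    show "strand m b (scarf_differential m v) \<tau> = 0"
    proof (cases "finite \<tau>")
      case True
      have "strand m b v \<sigma> = 0" for \<sigma>
        using v(2) b unfolding homogeneous_vec_iff_strand by blast
      then show ?thesis
        by (simp add: strand_scarf_differential[OF v(1) sub True] boundary_def)
    next
      case False
      then have "\<tau> \<notin> scarf_basis r m k" using finite_scarf_basis by blast
      then show ?thesis
        using free_module_strandD[OF scarf_differential_in_free_module[OF v(1)]] by blast
    qed
  qed
qed (auto simp: scarf_differential_in_free_module
    scarf_differential_add[OF scarf_basis_subset] scarf_differential_smult[OF scarf_basis_subset])

text \<open>In positive homological degree every face has a vertex \<open>l\<close>, and
  \<open>m l\<close> divides each degree in which the face occurs; this is the apex that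
  \<open>scarf_exact\<close> asks for.\<close>

lemma generic_scarf_exact:
  fixes m :: "nat \<Rightarrow> 'n::finite \<Rightarrow> nat"
  assumes gen: "generic r m"
  shows "{v \<in> free_module (scarf_basis r m (Suc k)). scarf_differential m v = 0} =
    scarf_differential m `
      (free_module (scarf_basis r m (Suc (Suc k))) :: (nat set \<Rightarrow>\<^sub>0 ('n, 'k::comm_ring_1) mpoly) set)"
proof (intro equalityI subsetI; (elim imageE CollectE conjE)?)
  fix v :: "nat set \<Rightarrow>\<^sub>0 ('n, 'k) mpoly"
  assume v: "v \<in> free_module (scarf_basis r m (Suc k))" "scarf_differential m v = 0"
  show "v \<in> scarf_differential m ` free_module (scarf_basis r m (Suc (Suc k)))"
  proof (rule scarf_exact[OF generic_strictly_divides[OF gen] v])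
    fix b \<sigma> assume s: "strand m b v \<sigma> \<noteq> 0"
    have "\<sigma> \<in> scarf_basis r m (Suc k)" by (rule free_module_strandD[OF v(1) s])
    then have \<sigma>: "\<sigma> \<subseteq> {1..r}" "\<sigma> \<noteq> {}"
      using scarf_basis_subset by (blast, auto simp: scarf_basis_def)
    then obtain l where l: "l \<in> \<sigma>" by blast
    then have "m l \<le> b"
      using le_lcm_exp[of \<sigma> l m] \<sigma>(1) strand_nonzero(2)[OF s] by (meson finite_subset_range order_trans)
    then show "\<exists>l\<in>{1..r}. m l \<le> b" using \<sigma>(1) l by blast
  qed
next
  fix v w :: "nat set \<Rightarrow>\<^sub>0 ('n, 'k) mpoly"
  assume "v = scarf_differential m w" "w \<in> free_module (scarf_basis r m (Suc (Suc k)))"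
  then show "v \<in> {v \<in> free_module (scarf_basis r m (Suc k)). scarf_differential m v = 0}"
    by (simp add: scarf_differential_in_free_module scarf_differential_differential)
qed

lemma generic_imp_scarf_resolution:
  fixes M :: "('n::finite, 'k::comm_ring_1) mpoly set"
  assumes min: "minimal_monomial_generators M r m" and gen: "generic r m"
  shows "free_resolution (scarf_basis r m) (lcm_exp m) (\<lambda>_. scarf_differential m) M"
  unfolding free_resolution_def
proof (intro conjI allI exI)
  note sub = scarf_basis_subset[of r m]
  have M: "M = ideal {monom (m j) | j. j \<in> {1..r}}"
    using min by (simp add: minimal_monomial_generators_def)
  have mem: "f \<in> M \<longleftrightarrow> (\<forall>b\<in>Poly_Mapping.keys f. \<exists>j\<in>{1..r}. m j \<le> b)" for f
    unfolding M ideal_monom by simp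
  let ?\<epsilon> = "\<lambda>v :: nat set \<Rightarrow>\<^sub>0 ('n, 'k) mpoly. residue_class M (Poly_Mapping.lookup v {})"
  {
    fix k
    show "graded_hom (lcm_exp m) (scarf_basis r m (Suc k)) (scarf_basis r m k)
        (scarf_differential m :: _ \<Rightarrow> nat set \<Rightarrow>\<^sub>0 ('n, 'k) mpoly)"
      by (rule scarf_differential_graded_hom)
  next
    fix k
    show "{v \<in> free_module (scarf_basis r m (Suc k)). scarf_differential m v = 0} =
        scarf_differential m `
          (free_module (scarf_basis r m (Suc (Suc k))) :: (nat set \<Rightarrow>\<^sub>0 ('n, 'k) mpoly) set)"
      by (rule generic_scarf_exact[OF gen])
  next
    show "graded_hom_to_quotient (lcm_exp m) (scarf_basis r m 0) M ?\<epsilon>"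
      by (rule augmentation_graded_hom[OF M])
  next
    show "?\<epsilon> ` free_module (scarf_basis r m 0) = range (residue_class M)"
    proof (cases "{} \<in> scarf_complex r m")
      case True
      have "residue_class M f \<in> ?\<epsilon> ` free_module (scarf_basis r m 0)" for f
        using True by (intro image_eqI[of _ _ "Poly_Mapping.single {} f"])
          (auto simp: free_module_def scarf_basis_def)
      then show ?thesis by blast
    next
      case False
      \<comment> \<open>Without the empty face some generator is 1, so \<open>M\<close> is the whole
        ring and the element 0 already hits the single residue class.\<close>
      then obtain i where i: "i \<in> {1..r}" "m i \<le> 0" by (auto simp: scarf_complex_iff)
      have "m i \<le> b" for b using i(2) by (auto simp: le_fun_def)
      then have "f \<in> M" for f using i mem by blast
      then have "residue_class M f = residue_class M g" for f g by (simp add: residue_class_def)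
      moreover have "0 \<in> free_module (scarf_basis r m 0)" by (simp add: free_module_def)
      ultimately show ?thesis by blast
    qed
  next
    have "v \<in> scarf_differential m ` free_module (scarf_basis r m 1) \<longleftrightarrow> Poly_Mapping.lookup v {} \<in> M"
      if v: "v \<in> free_module (scarf_basis r m 0)" for v :: "nat set \<Rightarrow>\<^sub>0 ('n, 'k) mpoly"
    proof
      assume "v \<in> scarf_differential m ` free_module (scarf_basis r m 1)"
      then obtain w :: "nat set \<Rightarrow>\<^sub>0 ('n, 'k) mpoly"
        where w: "w \<in> free_module (scarf_basis r m 1)" "v = scarf_differential m w" by blast
      show "Poly_Mapping.lookup v {} \<in> M" unfolding mem
      proof
        fix b assume "b \<in> Poly_Mapping.keys (Poly_Mapping.lookup v {})"
        then have "strand m b v {} \<noteq> 0" using strand_add[of m b "{}" v] by (simp add: in_keys_iff)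
        then have "boundary r (strand m b w) {} \<noteq> 0"
          by (simp add: w(2) strand_scarf_differential[OF w(1) sub])
        then obtain i where "i \<in> {1..r}" "strand m b w {i} \<noteq> 0" by (rule boundary_nonzeroE)
        then show "\<exists>j\<in>{1..r}. m j \<le> b" using strand_nonzero(2)[of m b w "{i}"] by auto
      qed
    next
      assume *: "Poly_Mapping.lookup v {} \<in> M"
      have 0: "\<sigma> = {}" if "\<sigma> \<in> scarf_basis r m 0" for \<sigma>
        using that sub[of 0] by (auto simp: scarf_basis_def)
      have "Poly_Mapping.lookup v (insert i \<tau>) = 0" for i \<tau>
        using v 0[of "insert i \<tau>"] unfolding in_free_module_iff by blast
      \<comment> \<open>Elements supported at the empty face are cycles, so
        \<open>scarf_exact\<close> applies here too, with the apex supplied by membership in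
        \<open>M\<close>.\<close>
      then have cycle: "scarf_differential m v = 0"
        by (intro poly_mapping_eqI) (simp add: lookup_scarf_differential[OF v sub])
      have "v \<in> scarf_differential m ` free_module (scarf_basis r m (Suc 0))"
      proof (rule scarf_exact[OF generic_strictly_divides[OF gen] v cycle])
        fix b \<sigma> assume s: "strand m b v \<sigma> \<noteq> 0"
        then have "\<sigma> = {}" using v 0 by (blast dest: free_module_strandD)
        then have "Poly_Mapping.lookup (Poly_Mapping.lookup v {}) b \<noteq> 0"
          using s strand_add[of m b "{}" v] by simp
        then show "\<exists>l\<in>{1..r}. m l \<le> b" using * unfolding mem by (simp add: in_keys_iff)
      qed
      then show "v \<in> scarf_differential m ` free_module (scarf_basis r m 1)" by simp
    qed
    moreover have "scarf_differential m ` free_module (scarf_basis r m 1) \<subseteq>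
        (free_module (scarf_basis r m 0) :: (nat set \<Rightarrow>\<^sub>0 ('n, 'k) mpoly) set)"
      using scarf_differential_in_free_module[of _ r m 0] by auto
    ultimately show "{v \<in> free_module (scarf_basis r m 0). ?\<epsilon> v = residue_class M 0} =
        scarf_differential m ` free_module (scarf_basis r m 1)"
      unfolding residue_class_eq_iff[OF M] by auto
  }
qed

text \<open>By the face test \<open>m i\<close> does not divide the lcm of
  \<open>\<sigma> - {i}\<close>, so the coefficients in the boundary of a face are non-constant
  monomials up to sign and lie in the ideal of the variables.\<close>

lemma scarf_differential_minimal:
  fixes v :: "nat set \<Rightarrow>\<^sub>0 ('n, 'k::comm_ring_1) mpoly"
  assumes v: "v \<in> free_module (scarf_basis r m (Suc k))"
  shows "scarf_differential m v \<in>
    smult.span {smult c v | c v. c \<in> ideal (range var) \<and> v \<in> free_module (scarf_basis r m k)}"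
  unfolding scarf_differential_def scarf_boundary_def
proof (intro smult.span_sum smult.span_scale)
  fix \<sigma> i assume "\<sigma> \<in> Poly_Mapping.keys v" and i: "i \<in> \<sigma>"
  then have \<sigma>: "\<sigma> \<in> scarf_complex r m" "card \<sigma> = Suc k"
    using v by (auto simp: free_module_def scarf_basis_def)
  let ?u = "lcm_exp m \<sigma> - lcm_exp m (\<sigma> - {i})"
  have sub: "\<sigma> \<subseteq> {1..r}" using \<sigma>(1) by (rule scarf_complex_subset)
  have "\<not> m i \<le> lcm_exp m (\<sigma> - {i})" using \<sigma>(1) sub i by (auto simp: scarf_complex_iff)
  moreover have "m i \<le> lcm_exp m \<sigma>" using sub i by (intro le_lcm_exp) auto
  ultimately have "?u \<noteq> 0"
    by (auto simp: le_fun_def fun_eq_iff) (metis order_trans)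
  then have "Poly_Mapping.single ?u (face_sign i \<sigma> :: 'k) \<in> ideal (range var)"
    by (rule single_in_maximal_ideal)
  moreover have "\<sigma> - {i} \<in> scarf_basis r m k"
    using \<sigma> i sub scarf_complex_downward[of \<sigma> r m "\<sigma> - {i}"] by (auto simp: scarf_basis_def)
  then have "Poly_Mapping.single (\<sigma> - {i}) 1 \<in> free_module (scarf_basis r m k)"
    by (simp add: free_module_def)
  moreover have "Poly_Mapping.single (\<sigma> - {i}) (Poly_Mapping.single ?u (face_sign i \<sigma> :: 'k)) =
      smult (Poly_Mapping.single ?u (face_sign i \<sigma>)) (Poly_Mapping.single (\<sigma> - {i}) 1)"
    by (intro poly_mapping_eqI) (simp add: lookup_single when_def)
  ultimately have "Poly_Mapping.single (\<sigma> - {i}) (Poly_Mapping.single ?u (face_sign i \<sigma> :: 'k)) \<in>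
      {smult c v | c v. c \<in> ideal (range var) \<and> v \<in> free_module (scarf_basis r m k)}"
    by (metis (mono_tags, lifting) mem_Collect_eq)
  then show "Poly_Mapping.single (\<sigma> - {i}) (Poly_Mapping.single ?u (face_sign i \<sigma> :: 'k)) \<in>
      smult.span {smult c v | c v. c \<in> ideal (range var) \<and> v \<in> free_module (scarf_basis r m k)}"
    by (rule smult.span_base)
qed

section \<open>Shared exponents along Scarf edges\<close>

lemma generic_scarf_edge:
  assumes gen: "generic r m" and edge: "i \<noteq> j" "{i, j} \<in> scarf_complex r m" and s: "m i s = m j s"
  shows "m i s = 0"
proof (rule ccontr)
  assume "m i s \<noteq> 0"
  moreover have "{i, j} \<subseteq> {1..r}" using edge(2) by (rule scarf_complex_subset)
  ultimately obtain l where "l \<in> {1..r}" "l \<noteq> i" "l \<noteq> j" "m l \<le> lcm_exp m {i, j}"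
    using gen edge(1) s unfolding generic_def by (metis insert_subset neq0_conv)
  \<comment> \<open>\<open>l\<close> lies outside the edge, so \<open>{i, j} - {l}\<close> is the
    edge itself and \<open>l\<close> fails the face test.\<close>
  then show False using edge(2) by (auto simp: scarf_complex_iff dest!: bspec[of _ _ l])
qed

text \<open>The monomial relation between \<open>m i\<close> and \<open>m j\<close> in the degree of
  their lcm is a cycle on the vertices \<open>{i}\<close> and \<open>{j}\<close>. Exactness makes it
  the image of Scarf edges whose lcm divides that degree, and one of them must contain
  \<open>j\<close>, where the coefficient is non-zero.\<close>

lemma scarf_neighbour_below:
  fixes m :: "nat \<Rightarrow> 'n \<Rightarrow> nat"
  assumes exact: "{v \<in> free_module (scarf_basis r m 1). scarf_differential m v = 0} =
      scarf_differential m ` (free_module (scarf_basis r m 2) :: (nat set \<Rightarrow>\<^sub>0 ('n, 'k::comm_ring_1) mpoly) set)"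
    and ij: "i \<noteq> j" "{i} \<in> scarf_complex r m" "{j} \<in> scarf_complex r m"
  obtains l where "l \<in> {1..r}" "l \<noteq> j" "{l, j} \<in> scarf_complex r m" "m l \<le> lcm_exp m {i, j}"
proof -
  define c where "c = lcm_exp m {i, j}"
  define g :: "nat set \<Rightarrow> 'k" where "g \<sigma> = (if \<sigma> = {i} then 1 else if \<sigma> = {j} then - 1 else 0)" for \<sigma>
  \<comment> \<open>This is \<open>x^(c - m i) e_{i} - x^(c - m j) e_{j}\<close>, concentrated in
    the single degree \<open>c\<close>.\<close>
  define v where "v = assemble r m {c} (\<lambda>_. g)"
  have r: "i \<in> {1..r}" "j \<in> {1..r}" using ij scarf_complex_subset by blast+
  have "m i \<le> c" "m j \<le> c" by (auto simp: c_def intro: le_lcm_exp)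
  then have sv: "strand m b v \<sigma> = (if b = c then g \<sigma> else 0)" for b \<sigma>
    unfolding v_def using r by (subst strand_assemble) (auto simp: g_def split: if_splits)
  have v: "v \<in> free_module (scarf_basis r m 1)"
    using ij by (intro free_module_strandI[of m]) (auto simp: sv g_def scarf_basis_def split: if_splits)
  have "boundary r g {} = 0"
  proof -
    have "boundary r g {} = (\<Sum>l\<in>{1..r}. (if l = i then 1 else 0) - (if l = j then 1 else 0))"
      unfolding boundary_def using ij(1)
      by (intro sum.cong) (auto simp: g_def face_sign_def Collect_conv_if)
    also have "\<dots> = 0" using r by (simp add: sum_subtractf)
    finally show ?thesis .
  qed
  \<comment> \<open>Adding a vertex to a non-empty set gives at least two elements, where
    \<open>g\<close> vanishes.\<close>
  moreover have "boundary r g \<tau> = 0" if "\<tau> \<noteq> {}" for \<tau>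
  proof -
    have "g (insert l \<tau>) = 0" if "l \<notin> \<tau>" for l
      using that \<open>\<tau> \<noteq> {}\<close> by (auto simp: g_def)
    then show ?thesis by (simp add: boundary_def)
  qed
  ultimately have g0: "boundary r g \<tau> = 0" for \<tau> by metis
  have "scarf_differential m v = 0"
  proof (rule strand_eqI)
    fix b \<tau>
    show "strand m b (scarf_differential m v) \<tau> = strand m b 0 \<tau>"
    proof (cases "finite \<tau>")
      case True
      have "boundary r (strand m b v) \<tau> = 0"
        using g0[of \<tau>] by (cases "b = c") (simp_all add: boundary_def sv)
      then show ?thesis using strand_scarf_differential[OF v scarf_basis_subset True, of m b]
        by simp
    next
      case False
      then have "\<tau> \<notin> scarf_basis r m 0" using finite_scarf_basis by blast
      then show ?thesis
        using free_module_strandD[OF scarf_differential_in_free_module, of v r m 0 m b \<tau>] v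
        by auto
    qed
  qed
  then obtain w :: "nat set \<Rightarrow>\<^sub>0 ('n, 'k) mpoly"
    where w: "w \<in> free_module (scarf_basis r m 2)" "v = scarf_differential m w"
    using v exact by blast
  have "strand m c v {j} \<noteq> 0" using ij(1) by (simp add: sv g_def)
  then have "boundary r (strand m c w) {j} \<noteq> 0"
    by (simp add: w(2) strand_scarf_differential[OF w(1) scarf_basis_subset])
  then obtain l where l: "l \<in> {1..r}" "l \<notin> {j}" "strand m c w {l, j} \<noteq> 0"
    by (rule boundary_nonzeroE)
  have "lcm_exp m {l, j} \<le> c" by (rule strand_nonzero(2)[OF l(3)])
  then have "m l \<le> c" using le_lcm_exp[of "{l, j}" l m] by (auto intro: order_trans)
  moreover have "{l, j} \<in> scarf_complex r m"
    using free_module_strandD[OF w(1) l(3)] by (simp add: scarf_basis_def)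
  ultimately show ?thesis using that[of l] l by (simp add: c_def)
qed

text \<open>
  Induction on the total degree of \<open>lcm(m\<^sub>i, m\<^sub>j)\<close>.  Unless \<open>m\<^sub>l\<close> strictly divides this lcm, a
  Scarf neighbour \<open>l\<close> of \<open>j\<close> below it shares with \<open>i\<close> a positive exponent at which it touches the
  lcm, since by assumption it cannot touch it together with \<open>j\<close>.  For the same reason
  \<open>lcm(m\<^sub>i, m\<^sub>l) = lcm(m\<^sub>i, m\<^sub>j)\<close> would force \<open>m\<^sub>j\<close> to divide \<open>m\<^sub>i\<close>.
\<close>

lemma scarf_exact_imp_strictly_divides:
  fixes m :: "nat \<Rightarrow> 'n::finite \<Rightarrow> nat"
  assumes exact: "{v \<in> free_module (scarf_basis r m 1). scarf_differential m v = 0} =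
      scarf_differential m ` (free_module (scarf_basis r m 2) :: (nat set \<Rightarrow>\<^sub>0 ('n, 'k::comm_ring_1) mpoly) set)"
    and incomparable: "\<And>i j. i \<in> {1..r} \<Longrightarrow> j \<in> {1..r} \<Longrightarrow> i \<noteq> j \<Longrightarrow> \<not> m i \<le> m j"
    and edge: "\<And>i j s. i \<noteq> j \<Longrightarrow> {i, j} \<in> scarf_complex r m \<Longrightarrow> m i s = m j s \<Longrightarrow> m i s = 0"
    and "i \<in> {1..r}" "j \<in> {1..r}" "i \<noteq> j" "m i s = m j s" "m i s > 0"
  shows "\<exists>l\<in>{1..r}. strictly_divides (m l) (lcm_exp m {i, j})"
  using assms(4-)
proof (induction "\<Sum>s\<in>UNIV. lcm_exp m {i, j} s" arbitrary: i j s rule: less_induct)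
  case less
  note ij = less.prems
  define c where "c = lcm_exp m {i, j}"
  \<comment> \<open>Incomparability excludes all \<open>l\<close> other than \<open>k\<close>; for
    \<open>l = k\<close> the test asks that \<open>m k\<close> is not 1, which the positive exponent
    ensures.\<close>
  have vertex: "{k} \<in> scarf_complex r m" if "k \<in> {1..r}" "m k s > 0" for k
    unfolding scarf_complex_iff
  proof (intro conjI ballI notI)
    fix l assume l: "l \<in> {1..r}" "m l \<le> lcm_exp m ({k} - {l})"
    show False
    proof (cases "l = k")
      case True
      then show False using l that(2) by (auto simp: le_fun_def dest: spec[of _ s])
    next
      case False
      then show False using l that incomparable[of l k] by simp
    qed
  qed (use that in auto)
  obtain l where l: "l \<in> {1..r}" "l \<noteq> j" "{l, j} \<in> scarf_complex r m" "m l \<le> c"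
    using scarf_neighbour_below[OF exact ij(3) vertex vertex] ij unfolding c_def by metis
  \<comment> \<open>Otherwise \<open>{i, j}\<close> itself would be an edge with the shared positive
    exponent at \<open>s\<close>.\<close>
  have "l \<noteq> i" using edge[OF ij(3), of s] l(3) ij by auto
  show ?case
  proof (cases "strictly_divides (m l) c")
    case False
    then obtain t where t: "m l t > 0" "c t \<le> m l t" by (auto simp: strictly_divides_def not_less)
    then have "m l t = c t" using l(4) by (simp add: le_fun_def antisym)
    \<comment> \<open>The edge \<open>{l, j}\<close> keeps \<open>m j\<close> below \<open>c\<close>
      at \<open>t\<close>, so \<open>m i\<close> attains the maximum there.\<close>
    moreover have "m j t \<noteq> m l t" using edge[OF l(2,3), of t] t by auto
    ultimately have it: "m i t = m l t" by (auto simp: c_def lcm_exp_pair max_def split: if_splits)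
    have le: "lcm_exp m {i, l} \<le> c" using l(4) by (auto simp: lcm_exp_le_iff c_def le_lcm_exp)
    have "lcm_exp m {i, l} \<noteq> c"
    proof
      assume eq: "lcm_exp m {i, l} = c"
      have "m j x \<le> m i x" for x
      proof (rule ccontr)
        assume "\<not> m j x \<le> m i x"
        moreover have "max (m i x) (m l x) = max (m i x) (m j x)"
          using fun_cong[OF eq, of x] by (simp add: c_def lcm_exp_pair)
        ultimately have "m l x = m j x" "m j x > 0" by (auto simp: max_def split: if_splits)
        then show False using edge[OF l(2,3), of x] by simp
      qed
      then show False using incomparable[of j i] ij by (simp add: le_fun_def)
    qed
    then have "(\<Sum>s\<in>UNIV. lcm_exp m {i, l} s) < (\<Sum>s\<in>UNIV. c s)"
      using le by (intro sum_strict_mono_ex1) (auto simp: le_fun_def fun_eq_iff order_less_le)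
    then obtain l' where "l' \<in> {1..r}" "strictly_divides (m l') (lcm_exp m {i, l})"
      using less.hyps[of i l t] ij(1) l(1) \<open>l \<noteq> i\<close> it t(1) by (auto simp: c_def)
    then show ?thesis using strictly_divides_mono le unfolding c_def by blast
  qed (use l(1) in \<open>auto simp: c_def\<close>)
qed

theorem theorem1p5:
  fixes M :: "('n::finite, 'k::field) mpoly set"
    and r :: nat
    and m :: "nat \<Rightarrow> 'n \<Rightarrow> nat"
  assumes "minimal_monomial_generators M r m"
  shows "generic r m \<longleftrightarrow>
    algebraic_scarf_complex_is_minimal_free_resolution r m M \<and>
    (\<forall>i j s. i \<noteq> j \<and> {i, j} \<in> scarf_complex r m \<longrightarrow> \<not> (m i s = m j s \<and> m i s \<noteq> 0))"
    (is "_ \<longleftrightarrow> ?resolution \<and> ?edges")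
proof (intro iffI conjI)
  assume gen: "generic r m"
  show ?resolution
    unfolding algebraic_scarf_complex_is_minimal_free_resolution_def minimal_free_resolution_def
    using generic_imp_scarf_resolution[OF assms gen] scarf_differential_minimal by blast
  show ?edges
  proof (intro allI impI notI; elim conjE)
    fix i j s assume "i \<noteq> j" "{i, j} \<in> scarf_complex r m" "m i s = m j s" "m i s \<noteq> 0"
    then show False using generic_scarf_edge[OF gen, of i j s] by simp
  qed
next
  assume R: "?resolution \<and> ?edges"
  have edge: "m i s = 0" if "i \<noteq> j" "{i, j} \<in> scarf_complex r m" "m i s = m j s" for i j s
    using conjunct2[OF R, rule_format, of i j s] that by simp
  have "\<forall>i. {v \<in> free_module (scarf_basis r m (Suc i)). scarf_differential m v = 0} =
      scarf_differential m `
        (free_module (scarf_basis r m (Suc (Suc i))) :: (nat set \<Rightarrow>\<^sub>0 ('n, 'k) mpoly) set)"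
    using R unfolding algebraic_scarf_complex_is_minimal_free_resolution_def
      minimal_free_resolution_def free_resolution_def by (elim conjE)
  then have "{v \<in> free_module (scarf_basis r m (Suc 0)). scarf_differential m v = 0} =
      scarf_differential m `
        (free_module (scarf_basis r m (Suc (Suc 0))) :: (nat set \<Rightarrow>\<^sub>0 ('n, 'k) mpoly) set)"
    by (rule spec)
  then have exact: "{v \<in> free_module (scarf_basis r m 1). scarf_differential m v = 0} =
      scarf_differential m ` (free_module (scarf_basis r m 2) :: (nat set \<Rightarrow>\<^sub>0 ('n, 'k) mpoly) set)"
    by (simp add: numeral_2_eq_2)
  show "generic r m"
    unfolding generic_def
  proof (intro ballI impI)
    fix i j assume i: "i \<in> {1..r}" and j: "j \<in> {1..r}"
      and "i \<noteq> j \<and> (\<exists>s. m i s = m j s \<and> m i s > 0)"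
    then obtain s where s: "i \<noteq> j" "m i s = m j s" "m i s > 0" by blast
    have "\<exists>l\<in>{1..r}. strictly_divides (m l) (lcm_exp m {i, j})"
      by (rule scarf_exact_imp_strictly_divides[OF exact _ _ i j s])
        (erule (2) minimal_monomial_generators_incomparable[OF assms], erule (2) edge)
    then obtain l where l: "l \<in> {1..r}" "strictly_divides (m l) (lcm_exp m {i, j})" by blast
    \<comment> \<open>At \<open>s\<close> the lcm equals the shared exponent, which
      \<open>m l\<close> does not reach, so \<open>l\<close> is a third generator.\<close>
    have "m l s = 0 \<or> m l s < m i s"
      using l(2) s(2) by (auto simp: strictly_divides_def lcm_exp_pair dest: spec[of _ s])
    then have "l \<noteq> i" "l \<noteq> j" using s by auto
    then show "\<exists>l\<in>{1..r}. l \<noteq> i \<and> l \<noteq> j \<and> m l \<le> lcm_exp m {i, j} \<and>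
        supp (lcm_exp m {i, j} - m l) = supp (lcm_exp m {i, j})"
      using l by (auto simp: strictly_divides_iff_supp)
  qed
qed

end
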